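(* Let $K$ be a field and $P=K[x_1,\dots,x_n]$ with $n\ge1$. Let $\mathcal F=\{f_1,\ldots,f_s\}\subset P\setminus\{0\}$ be a set of marked polynomials, with marking $\mathrm{MT}_{\mathcal F}$, such that $\mathrm{MT}_{\mathcal F}(f_i)\notin\mathrm{Supp}(f_j)$ for $1\le i,j\le s$, $i\neq j$. Assume that the ideal $I=\langle\mathcal F\rangle_P$ generated by $\mathcal F$ is zero-dimensional. Consider the following procedure (the Border Basis Algorithm with Term Marking Strategy). (T1) Let $\mathcal U$ be the order ideal spanned by $\bigcup_{i=1}^s\mathrm{Supp}(f_i)$. (T2) Compute a $K$-vector space basis $\mathcal V$ of $\langle\mathcal F\rangle_K$ with pairwise different marked terms: apply the Marked Interreduction to $\{f_1,\ldots,f_s\}$ to obtain $\mathcal V=\{f'_1,\ldots,f'_m\}$. (T3) Compute a $K$-vector space basis $\mathcal V'\cup\mathcal W'$ of $\langle\mathcal V^+\rangle_K$ such that the elements of $\mathcal V'\cup\mathcal W'$ have pairwise different marked terms and $\mathrm{MT}_{\mathcal V'\cup\mathcal W'}(v)\notin\mathrm{Supp}(w)$ for all $v,w\in\mathcal V'\cup\mathcal W'$, $v\ne w$, as follows: a) Mark in all $x_iv\in\mathcal V^+\setminus\mathcal V$, $1\le i\le n$, $v\in\mathcal V$, the term $x_it$ where $t\in\mathrm{Supp}(v)$ is the marked term of $v$. b) Let $\mathcal V=\{v_1,\ldots,v_k\}$ and $\mathcal V^+\setminus\mathcal V=\{v'_1,\ldots,v'_{k'}\}$ and apply the Marked Interreduction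 to $\{v_1,\ldots,v_k,v'_1,\ldots,v'_{k'}\}$ (in this order) to obtain $\tilde{\mathcal V}$. c) Let $T=\{\mathrm{MT}_{\mathcal V}(v)\mid v\in\mathcal V\}$, $\mathcal V'=\{\tilde f\in\tilde{\mathcal V}\mid\mathrm{MT}_{\tilde{\mathcal V}}(\tilde f)\in T\}$ and $\mathcal W'=\tilde{\mathcal V}\setminus\mathcal V'$. (T4) Let $\mathcal W=\{w\in\mathcal W'\mid\mathrm{MT}_{\mathcal W'}(w)\in\mathcal U\}$. (T5) If $\bigcup_{w\in\mathcal W}\mathrm{Supp}(w)\nsubseteq\mathcal U$ then replace $\mathcal U$ by the order ideal spanned by $\mathcal U$ and $\bigcup_{w\in\mathcal W}\mathrm{Supp}(w)$ and continue with (T4). (T6) If $\mathcal W\ne\emptyset$ then replace $\mathcal V$ by $\mathcal V'\cup\mathcal W$ and continue with (T3). (T7) Let $\mathcal O=\mathcal U\setminus\{\mathrm{MT}_{\mathcal V}(v)\mid v\in\mathcal V\}$. If $\mathcal O$ is not an order ideal then stop and output "$\mathcal O$ is not an order ideal in step (T7).". (T8) If $\partial\mathcal O\nsubseteq\mathcal U$ then replace $\mathcal U$ by the order ideal $\mathcal U^+$ and continue with (T3). (T9) Select in $\mathcal V$ those $g_1,\ldots,g_\nu$ which satisfy $\mathrm{MT}_{\mathcal V}(g_i)\in\partial\mathcal O$, $1\le i\le\nu$. Output $\{g_1,\ldots,g_\nu\}$ and its marking as well as $\mathcal O$. Then this is an algorithm (it terminates), and it either stops without a result in step (T7), or it computes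 an order ideal $\mathcal O$ of terms and a set of marked polynomials $\{g_1,\ldots,g_\nu\}$ such that $\{g_1,\ldots,g_\nu\}$ is the $\mathcal O$-border basis of $I$ and such that, whenever $g\in\{g_1,\ldots,g_\nu\}$ and $t\in\mathrm{Supp}(g)$ satisfy $t\in\partial\mathcal O$, the term $t$ is marked in $g$.
   Context: $\mathbb T^n=\{x_1^{\alpha_1}\cdots x_n^{\alpha_n}\mid\alpha_i\ge0\}$ is the set of terms. $\mathrm{Supp}(f)$ is the set of terms occurring in $f$ with nonzero coefficient; $\deg$ is total degree; $\langle\cdot\rangle_K$ is $K$-linear span. **Order ideals.** A set $\mathcal O\subseteq\mathbb T^n$ is an order ideal if $t'\in\mathcal O$ and $t\mid t'$ ($t,t'\in\mathbb T^n$) imply $t\in\mathcal O$. The order ideal spanned by a set of terms is the set of all divisors of these terms. Only finite order ideals are considered. The border of $\mathcal O$ is $\partial\mathcal O=(x_1\mathcal O\cup\cdots\cup x_n\mathcal O)\setminus\mathcal O$, with $\partial\emptyset=\{1\}$. For a set $F\subset P$, $F^+=F\cup x_1F\cup\cdots\cup x_nF$ (applied both to sets of polynomials and sets of terms). **Border bases.** Let $\mathcal O=\{t_1,\dots,t_\mu\}$ be an order ideal with $\partial\mathcal O=\{b_1,\dots,b_\nu\}$. A set $G=\{g_1,\dots,g_\nu\}\subset P$ is an $\mathcal O$-border prebasis if $g_j=b_j-\sum_{i=1}^\mu\alpha_{ij}t_i$ with $\alpha_{ij}\in K$ for $1\le j\le\nu$. An $\mathcal O$-border prebasis $G$ is an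 $\mathcal O$-border basis of an ideal $I\subseteq P$ if $G\subset I$ and the residue classes $\overline{t_1},\dots,\overline{t_\mu}$ form a $K$-vector space basis of $P/I$ (it is then unique). **Markings.** For $\mathcal F\subseteq P\setminus\{0\}$, a marking of $\mathcal F$ is a mapping $\mathrm{MT}_{\mathcal F}:\mathcal F\to\bigcup_{f\in\mathcal F}\mathrm{Supp}(f)$ with $\mathrm{MT}_{\mathcal F}(f)\in\mathrm{Supp}(f)$ and $\deg(\mathrm{MT}_{\mathcal F}(f))=\deg(f)$ for all $f\in\mathcal F$. The polynomials of $\mathcal F$ are called marked if such a mapping is given; $\mathrm{MT}_{\mathcal F}(f)$ is the marked term of $f$. Subsets of marked sets inherit the marking (so $\mathcal V',\mathcal W',\mathcal W,\mathcal V'\cup\mathcal W$ carry the marking of $\tilde{\mathcal V}$). If in (T3) a) the same polynomial arises as $x_iv$ in several ways with different terms $x_it$, any one of these terms may be chosen as its marked term. **Marked Interreduction.** Input: a list $f_1,\ldots,f_s$ of distinct nonzero marked polynomials. Enumerate $\bigcup_i\mathrm{Supp}(f_i)=\{t_1,\ldots,t_l\}$ in any way with $\deg(t_1)\ge\cdots\ge\deg(t_l)$. (1) Write $f_i=\sum_ja_{ij}t_j$ with $a_{ij}\in K$. (2) Let $p_i$ be the index such that the marked term of $f_i$ is $t_{p_i}$. (3) For $i=1,\ldots,s$ perform (4)-(6). (4) If $a_{ip_i}\ne0$, multiply row $i$ of $(a_{ij})$ by $a_{ip_i}^{-1}$. (5) For each $k\in\{1,\ldots,s\}\setminus\{i\}$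 with $a_{kp_i}\ne0$, subtract $a_{kp_i}$ times row $i$ from row $k$. (6) For each $k=i+1,\ldots,s$ with $a_{kp_k}=0$, let $j$ be the minimum column index with $a_{kj}\ne0$, if it exists, and set $p_k:=j$. (7) Return the set of all nonzero polynomials $\sum_ja_{ij}t_j$, $i=1,\ldots,s$, where the $i$-th one has marked term $t_{p_i}$. *)

theory Defs
  imports "HOL-Library.Poly_Mapping" Complex_Main
begin

text \<open>
  Terms are exponent vectors, written additively: the term 1 is \<open>0\<close>, the product of two terms is
  their sum, and the indeterminate \<open>x\<^sub>i\<close> is \<open>tvar i\<close>.  The indeterminates are indexed by a finite
  (hence nonempty) type \<open>'n\<close>.
\<close>

type_synonym 'n pterm = "'n \<Rightarrow>\<^sub>0 nat"
type_synonym ('n, 'k) mpoly = "'n pterm \<Rightarrow>\<^sub>0 'k"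

abbreviation supp :: "('n, 'k::zero) mpoly \<Rightarrow> 'n pterm set"
  where "supp f \<equiv> Poly_Mapping.keys f"

abbreviation coeff :: "('n, 'k::zero) mpoly \<Rightarrow> 'n pterm \<Rightarrow> 'k"
  where "coeff f \<equiv> Poly_Mapping.lookup f"

abbreviation monomial :: "'k::zero \<Rightarrow> 'n pterm \<Rightarrow> ('n, 'k) mpoly"
  where "monomial c t \<equiv> Poly_Mapping.single t c"

definition tvar :: "'n \<Rightarrow> 'n pterm"
  where "tvar i = Poly_Mapping.single i 1"

definition pvar :: "'n \<Rightarrow> ('n, 'k::field) mpoly"
  where "pvar i = monomial 1 (tvar i)"

definition tdvd :: "'n pterm \<Rightarrow> 'n pterm \<Rightarrow> bool"
  where "tdvd t t' \<longleftrightarrow> (\<exists>s. t' = t + s)"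

definition tdeg :: "'n::finite pterm \<Rightarrow> nat"
  where "tdeg t = (\<Sum>i\<in>UNIV. Poly_Mapping.lookup t i)"

text \<open>Only meaningful for nonzero polynomials.\<close>

definition pdeg :: "('n::finite, 'k::zero) mpoly \<Rightarrow> nat"
  where "pdeg f = Max (tdeg ` supp f)"


subsection \<open>Linear spans, ideals, residue classes\<close>

definition pscale :: "'k::field \<Rightarrow> ('n, 'k) mpoly \<Rightarrow> ('n, 'k) mpoly"
  where "pscale c f = monomial c 0 * f"

global_interpretation Kvs: vector_space "pscale :: 'k::field \<Rightarrow> ('n, 'k) mpoly \<Rightarrow> ('n, 'k) mpoly"
  by unfold_locales
    (simp_all add: pscale_def algebra_simps single_add mult_single flip: mult.assoc)

global_interpretation Pmod:
  module "(*) :: ('n, 'k::field) mpoly \<Rightarrow> ('n, 'k) mpoly \<Rightarrow> ('n, 'k) mpoly"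
  by unfold_locales (simp_all add: algebra_simps)

abbreviation Kspan :: "('n, 'k::field) mpoly set \<Rightarrow> ('n, 'k) mpoly set"
  where "Kspan \<equiv> Kvs.span"

definition is_K_basis :: "('n, 'k::field) mpoly set \<Rightarrow> ('n, 'k) mpoly set \<Rightarrow> bool"
  where "is_K_basis B S \<longleftrightarrow> Kvs.independent B \<and> Kspan B = S"

abbreviation ideal_of :: "('n, 'k::field) mpoly set \<Rightarrow> ('n, 'k) mpoly set"
  where "ideal_of \<equiv> Pmod.span"

text \<open>The \<open>K\<close>-vector space \<open>P/I\<close> is finite-dimensional; the unit ideal is included.\<close>

definition zero_dimensional :: "('n, 'k::field) mpoly set \<Rightarrow> bool"
  where "zero_dimensional I \<longleftrightarrow> (\<exists>B. finite B \<and> (\<forall>f. \<exists>g\<in>Kspan B. f - g \<in> I))"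

text \<open>
  The residue classes in \<open>P/I\<close> of the terms in the finite set \<open>\<O>\<close>, as a family indexed by \<open>\<O>\<close>, are
  linearly independent over \<open>K\<close> and generate \<open>P/I\<close>.
\<close>

definition residue_basis :: "'n pterm set \<Rightarrow> ('n, 'k::field) mpoly set \<Rightarrow> bool"
  where "residue_basis \<O> I \<longleftrightarrow>
    (\<forall>c. (\<Sum>t\<in>\<O>. monomial (c t) t) \<in> I \<longrightarrow> (\<forall>t\<in>\<O>. c t = 0)) \<and>
    (\<forall>f. \<exists>c. f - (\<Sum>t\<in>\<O>. monomial (c t) t) \<in> I)"


subsection \<open>Order ideals and border bases\<close>

definition order_ideal :: "'n pterm set \<Rightarrow> bool"
  where "order_ideal \<O> \<longleftrightarrow> (\<forall>t'\<in>\<O>. \<forall>t. tdvd t t' \<longrightarrow> t \<in> \<O>)"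

definition order_ideal_span :: "'n pterm set \<Rightarrow> 'n pterm set"
  where "order_ideal_span S = {t. \<exists>t'\<in>S. tdvd t t'}"

definition border :: "'n pterm set \<Rightarrow> 'n pterm set"
  where "border \<O> = (if \<O> = {} then {0} else (\<Union>i. (\<lambda>t. tvar i + t) ` \<O>) - \<O>)"

definition tplus :: "'n pterm set \<Rightarrow> 'n pterm set"
  where "tplus S = S \<union> (\<Union>i. (\<lambda>t. tvar i + t) ` S)"

definition pplus :: "('n, 'k::field) mpoly set \<Rightarrow> ('n, 'k) mpoly set"
  where "pplus S = S \<union> (\<Union>i. (\<lambda>f. pvar i * f) ` S)"

text \<open>
  The polynomials attached to different border terms are automatically different, so a border
  prebasis is the image of the border under a map of this form.
\<close>

definition border_prebasis :: "'n pterm set \<Rightarrow> ('n, 'k::field) mpoly set \<Rightarrow> bool"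
  where "border_prebasis \<O> G \<longleftrightarrow> finite \<O> \<and> order_ideal \<O> \<and>
    (\<exists>\<alpha>. G = (\<lambda>b. monomial 1 b - (\<Sum>t\<in>\<O>. monomial (\<alpha> t b) t)) ` border \<O>)"

definition border_basis ::
    "'n pterm set \<Rightarrow> ('n, 'k::field) mpoly set \<Rightarrow> ('n, 'k) mpoly set \<Rightarrow> bool"
  where "border_basis \<O> G I \<longleftrightarrow> border_prebasis \<O> G \<and> G \<subseteq> I \<and> residue_basis \<O> I"


subsection \<open>Markings and Marked Interreduction\<close>

text \<open>
  A marking of \<open>F\<close> is represented by a total function of which only the values on \<open>F\<close> matter, so
  subsets of \<open>F\<close> inherit it by keeping the same function.
\<close>

definition is_marking ::
    "('n::finite, 'k::zero) mpoly set \<Rightarrow> (('n, 'k) mpoly \<Rightarrow> 'n pterm) \<Rightarrow> bool"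
  where "is_marking F mt \<longleftrightarrow> (\<forall>f\<in>F. mt f \<in> supp f \<and> tdeg (mt f) = pdeg f)"

text \<open>
  Row operations on an \<open>s \<times> l\<close> matrix \<open>a\<close> with pivot columns \<open>p\<close>; rows and columns are numbered from
  0, and entries outside the matrix are never used.  The three stages are: normalise row \<open>i\<close>, clear
  column \<open>p i\<close> in all other rows, choose new pivot columns below row \<open>i\<close> where necessary.
\<close>

definition interreduction_step ::
    "nat \<Rightarrow> nat \<Rightarrow> nat \<Rightarrow> (nat \<Rightarrow> nat \<Rightarrow> 'k::field) \<times> (nat \<Rightarrow> nat) \<Rightarrow>
      (nat \<Rightarrow> nat \<Rightarrow> 'k) \<times> (nat \<Rightarrow> nat)"
  where "interreduction_step s l i = (\<lambda>(a, p).
    let a1 = (if a i (p i) \<noteq> 0 then a(i := (\<lambda>j. inverse (a i (p i)) * a i j)) else a);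
        a2 = (\<lambda>k. if k < s \<and> k \<noteq> i \<and> a1 k (p i) \<noteq> 0
                   then (\<lambda>j. a1 k j - a1 k (p i) * a1 i j) else a1 k);
        p' = (\<lambda>k. if i < k \<and> k < s \<and> a2 k (p k) = 0 \<and> (\<exists>j<l. a2 k j \<noteq> 0)
                   then (LEAST j. j < l \<and> a2 k j \<noteq> 0) else p k)
    in (a2, p'))"

text \<open>
  \<open>marked_interreduction fs mt G mt'\<close>: the list \<open>fs\<close>, marked by \<open>mt\<close>, is admissible input, and
  \<open>G\<close>, marked by \<open>mt'\<close>, is a result for some enumeration \<open>ts\<close> of the terms by decreasing degree.
\<close>

definition marked_interreduction ::
    "('n::finite, 'k::field) mpoly list \<Rightarrow> (('n, 'k) mpoly \<Rightarrow> 'n pterm) \<Rightarrow>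
      ('n, 'k) mpoly set \<Rightarrow> (('n, 'k) mpoly \<Rightarrow> 'n pterm) \<Rightarrow> bool"
  where "marked_interreduction fs mt G mt' \<longleftrightarrow>
    distinct fs \<and> 0 \<notin> set fs \<and> is_marking (set fs) mt \<and>
    (\<exists>ts. distinct ts \<and> set ts = (\<Union>f\<in>set fs. supp f) \<and>
      sorted_wrt (\<lambda>t u. tdeg t \<ge> tdeg u) ts \<and>
      (let s = length fs; l = length ts;
           a0 = (\<lambda>i j. coeff (fs ! i) (ts ! j));
           p0 = (\<lambda>i. THE j. j < l \<and> ts ! j = mt (fs ! i));
           (a, p) = fold (interreduction_step s l) [0..<s] (a0, p0);
           row = (\<lambda>i. \<Sum>j<l. monomial (a i j) (ts ! j))
       in G = {row i |i. i < s \<and> row i \<noteq> 0} \<and>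
          (\<forall>i<s. row i \<noteq> 0 \<longrightarrow> mt' (row i) = ts ! p i)))"


subsection \<open>The Border Basis Algorithm with Term Marking Strategy\<close>

text \<open>
  The procedure is a nondeterministic transition system; the nondeterminism covers all the choices
  left open: the orders of the lists, the enumerations of terms in the Marked Interreduction, the
  marked terms of products arising in several ways.  In the type of states, \<open>'t\<close> stands for terms and
  \<open>'p\<close> for polynomials.  A state \<open>At_Tj\<close> records the step to be executed
  next and the current values of the variables that are still needed.  Marking the products (T3 a) and
  reducing them (T3 b, c) are separate transitions, so that an inadmissible marking would show up as
  a state without successor.  A set of marked polynomials
  is given by the set and its marking; \<open>\<V>'\<close>, \<open>\<W>'\<close>, \<open>\<W>\<close> share one marking.
\<close>

datatype ('t, 'p) bba_state =
    At_T1
  | At_T2 "'t set" \<comment> \<open>\<open>\<U>\<close>\<close>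
  | At_T3 "'t set" "'p set" "'p \<Rightarrow> 't" \<comment> \<open>\<open>\<U>\<close>, \<open>\<V>\<close>\<close>
  | At_T3b "'t set" "'p set" "'p \<Rightarrow> 't" \<comment> \<open>\<open>\<U>\<close>, \<open>\<V>\<close>; the marking covers \<open>pplus \<V>\<close>\<close>
  | At_T4 "'t set" "'p set" "'p \<Rightarrow> 't"
      "'p set" "'p set" "'p \<Rightarrow> 't" \<comment> \<open>\<open>\<U>\<close>, \<open>\<V>\<close>; \<open>\<V>'\<close>, \<open>\<W>'\<close>\<close>
  | At_T5 "'t set" "'p set" "'p \<Rightarrow> 't"
      "'p set" "'p set" "'p set" "'p \<Rightarrow> 't"
      \<comment> \<open>\<open>\<U>\<close>, \<open>\<V>\<close>; \<open>\<V>'\<close>, \<open>\<W>'\<close>, \<open>\<W>\<close>\<close>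
  | At_T6 "'t set" "'p set" "'p \<Rightarrow> 't"
      "'p set" "'p set" "'p \<Rightarrow> 't" \<comment> \<open>\<open>\<U>\<close>, \<open>\<V>\<close>; \<open>\<V>'\<close>, \<open>\<W>\<close>\<close>
  | At_T7 "'t set" "'p set" "'p \<Rightarrow> 't" \<comment> \<open>\<open>\<U>\<close>, \<open>\<V>\<close>\<close>
  | At_T8 "'t set" "'p set" "'p \<Rightarrow> 't" "'t set" \<comment> \<open>\<open>\<U>\<close>, \<open>\<V>\<close>, \<open>\<O>\<close>\<close>
  | At_T9 "'p set" "'p \<Rightarrow> 't" "'t set" \<comment> \<open>\<open>\<V>\<close>, \<open>\<O>\<close>\<close>
  | Stopped_in_T7 "'t set" \<comment> \<open>the message about \<open>\<O>\<close>\<close>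
  | Output "'p set" "'p \<Rightarrow> 't" "'t set" \<comment> \<open>\<open>g\<^sub>1, \<dots>, g\<^sub>\<nu>\<close>, \<open>\<O>\<close>\<close>

inductive bba_step ::
    "('n::finite, 'k::field) mpoly set \<Rightarrow> (('n, 'k) mpoly \<Rightarrow> 'n pterm) \<Rightarrow>
      ('n pterm, ('n, 'k) mpoly) bba_state \<Rightarrow> ('n pterm, ('n, 'k) mpoly) bba_state \<Rightarrow> bool"
  for F MT where
  T1: "bba_step F MT At_T1 (At_T2 (order_ideal_span (\<Union>f\<in>F. supp f)))"
| T2: "\<lbrakk>distinct fs; set fs = F; marked_interreduction fs MT \<V> mt\<rbrakk>
    \<Longrightarrow> bba_step F MT (At_T2 \<U>) (At_T3 \<U> \<V> mt)"
| T3a: "\<lbrakk>\<forall>v\<in>\<V>. mt\<^sub>1 v = mt v;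
      \<forall>f\<in>pplus \<V> - \<V>. \<exists>i. \<exists>v\<in>\<V>. f = pvar i * v \<and> mt\<^sub>1 f = tvar i + mt v\<rbrakk>
    \<Longrightarrow> bba_step F MT (At_T3 \<U> \<V> mt) (At_T3b \<U> \<V> mt\<^sub>1)"
| T3bc: "\<lbrakk>distinct vs; set vs = \<V>; distinct vs'; set vs' = pplus \<V> - \<V>;
      marked_interreduction (vs @ vs') mt \<V>\<^sub>t mt';
      \<V>' = {f \<in> \<V>\<^sub>t. mt' f \<in> mt ` \<V>}; \<W>' = \<V>\<^sub>t - \<V>'\<rbrakk>
    \<Longrightarrow> bba_step F MT (At_T3b \<U> \<V> mt) (At_T4 \<U> \<V> mt \<V>' \<W>' mt')"
| T4: "\<W> = {w \<in> \<W>'. mt' w \<in> \<U>}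
    \<Longrightarrow> bba_step F MT (At_T4 \<U> \<V> mt \<V>' \<W>' mt') (At_T5 \<U> \<V> mt \<V>' \<W>' \<W> mt')"
| T5_extend: "\<lbrakk>\<not> (\<Union>w\<in>\<W>. supp w) \<subseteq> \<U>; \<U>' = order_ideal_span (\<U> \<union> (\<Union>w\<in>\<W>. supp w))\<rbrakk>
    \<Longrightarrow> bba_step F MT (At_T5 \<U> \<V> mt \<V>' \<W>' \<W> mt') (At_T4 \<U>' \<V> mt \<V>' \<W>' mt')"
| T5_next: "(\<Union>w\<in>\<W>. supp w) \<subseteq> \<U>
    \<Longrightarrow> bba_step F MT (At_T5 \<U> \<V> mt \<V>' \<W>' \<W> mt') (At_T6 \<U> \<V> mt \<V>' \<W> mt')"
| T6_repeat: "\<W> \<noteq> {}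
    \<Longrightarrow> bba_step F MT (At_T6 \<U> \<V> mt \<V>' \<W> mt') (At_T3 \<U> (\<V>' \<union> \<W>) mt')"
| T6_next: "\<W> = {}
    \<Longrightarrow> bba_step F MT (At_T6 \<U> \<V> mt \<V>' \<W> mt') (At_T7 \<U> \<V> mt)"
| T7_stop: "\<lbrakk>\<O> = \<U> - mt ` \<V>; \<not> order_ideal \<O>\<rbrakk>
    \<Longrightarrow> bba_step F MT (At_T7 \<U> \<V> mt) (Stopped_in_T7 \<O>)"
| T7_next: "\<lbrakk>\<O> = \<U> - mt ` \<V>; order_ideal \<O>\<rbrakk>
    \<Longrightarrow> bba_step F MT (At_T7 \<U> \<V> mt) (At_T8 \<U> \<V> mt \<O>)"
| T8_extend: "\<not> border \<O> \<subseteq> \<U>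
    \<Longrightarrow> bba_step F MT (At_T8 \<U> \<V> mt \<O>) (At_T3 (tplus \<U>) \<V> mt)"
| T8_next: "border \<O> \<subseteq> \<U>
    \<Longrightarrow> bba_step F MT (At_T8 \<U> \<V> mt \<O>) (At_T9 \<V> mt \<O>)"
| T9: "G = {g \<in> \<V>. mt g \<in> border \<O>}
    \<Longrightarrow> bba_step F MT (At_T9 \<V> mt \<O>) (Output G mt \<O>)"

definition bba_reachable ::
    "('n::finite, 'k::field) mpoly set \<Rightarrow> (('n, 'k) mpoly \<Rightarrow> 'n pterm) \<Rightarrow>
      ('n pterm, ('n, 'k) mpoly) bba_state \<Rightarrow> bool"
  where "bba_reachable F MT = (bba_step F MT)\<^sup>*\<^sup>* At_T1"

end

theory Submission
  imports Defs "HOL-Library.FuncSet"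
begin

text \<open>
  The marked terms play the part of the leading terms of a term ordering, but all that is used of them
  is that they have maximal degree in their polynomials and that the sets of polynomials concerned are
  reduced: no marked term occurs in another element (\<open>marked_reduced\<close>).  This is a reduced row
  echelon form whose pivots are the marked terms, so membership in the span and coordinates can be read
  off from coefficients.  The Marked Interreduction is a Gauss-Jordan elimination that produces such sets
  without changing the span; since \<open>V\<close> is already reduced and stands first, it also keeps all marked
  terms of \<open>V\<close> (\<open>marked_interreduction_correct\<close>).

  Consequently one round (T3)--(T6) with universe \<open>U\<close> either strictly enlarges \<open>V\<close>, still supported in
  \<open>U\<close>, or finds that \<open>V\<close> is stable: every polynomial in the span of \<open>pplus V\<close> that is supported in \<open>U\<close>
  is already in the span of \<open>V\<close> (\<open>card_less_next\<close>, \<open>stable_if_no_new\<close>).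

  Termination.  Within (T5) the universe absorbs polynomials whose marked terms, of maximal degree, are
  in it; its maximal degree does not grow, and this bounds the size of \<open>V\<close> as long as (T8) does not
  extend the universe.  Extensions in (T8) are bounded in number as well.  As the quotient by the ideal
  is finite-dimensional, there is \<open>D\<close> such that every term of degree \<open>D\<close> is congruent to a polynomial of
  smaller degree, and these finitely many congruences are derived from \<open>F\<close> inside some degree \<open>M\<close>.  Once
  \<open>U\<close> contains all terms up to degree \<open>M\<close>, stability puts them into the span of \<open>V\<close> and propagates them
  to all terms of \<open>U\<close> of degree at least \<open>D\<close>.  Marked terms having maximal degree, all these terms are
  marked (\<open>unmarked_degree_bound\<close>), so \<open>\<O>\<close> lives in degrees below \<open>D\<close> and its border lies in \<open>U\<close>.

  Correctness.  Let \<open>\<O> = U - mt ` V\<close> be an order ideal with border inside \<open>U\<close>.  Multiplying by an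
  indeterminate and then cancelling marked terms is an operator on the span of \<open>\<O>\<close>, and by stability
  these operators commute (\<open>rem_pvar_times_commute\<close>).  Hence they make the span of \<open>\<O>\<close> a
  module over the polynomial ring, and there is a normal form map onto it whose kernel is an ideal that
  contains \<open>F\<close>; it is the identity on the span of \<open>\<O>\<close>, which therefore meets the ideal only in 0.
  Conversely the span of \<open>\<O>\<close> and the ideal add up to the whole ring, because their sum contains 1 and is
  closed under multiplication by the indeterminates (\<open>decomposition_mod_ideal\<close>).
\<close>

section \<open>Terms and order ideals\<close>

abbreviation terms_upto :: "nat \<Rightarrow> 'n::finite pterm set"
  where "terms_upto d \<equiv> {t. tdeg t \<le> d}"

lemma tdeg_zero [simp]: "tdeg 0 = 0"
  by (simp add: tdeg_def)

lemma tdeg_add: "tdeg (s + t) = tdeg s + tdeg t"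
  by (simp add: tdeg_def lookup_add sum.distrib)

lemma tdeg_tvar [simp]: "tdeg (tvar i) = 1"
  by (simp add: tdeg_def tvar_def lookup_single when_def)

lemma tdeg_tvar_add [simp]: "tdeg (tvar i + t) = Suc (tdeg t)"
  by (simp add: tdeg_add)

lemma pterm_neq_0E:
  assumes "t \<noteq> 0"
  obtains i t' where "t = tvar i + t'"
proof -
  from assms obtain i where i: "Poly_Mapping.lookup t i \<noteq> 0"
    by (metis lookup_zero poly_mapping_eqI)
  have "t = tvar i + (t - tvar i)"
    using i by (intro poly_mapping_eqI)
      (auto simp: tvar_def lookup_add lookup_minus lookup_single when_def)
  then show ?thesis by (rule that)
qed

lemma tdeg_eq_0_iff [simp]: "tdeg t = 0 \<longleftrightarrow> t = 0"
  by (cases "t = 0") (auto elim: pterm_neq_0E)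

lemma finite_terms_upto [simp]: "finite (terms_upto d :: 'n::finite pterm set)"
proof (rule finite_imageD)
  have "Poly_Mapping.lookup ` (terms_upto d :: 'n pterm set) \<subseteq> Pi\<^sub>E UNIV (\<lambda>_. {..d})"
  proof (clarsimp simp: PiE_def Pi_def)
    fix t :: "'n pterm" and i assume "tdeg t \<le> d"
    moreover have "Poly_Mapping.lookup t i \<le> tdeg t"
      unfolding tdeg_def by (rule member_le_sum) auto
    ultimately show "Poly_Mapping.lookup t i \<le> d" by linarith
  qed
  then show "finite (Poly_Mapping.lookup ` (terms_upto d :: 'n pterm set))"
    by (rule finite_subset) (simp add: finite_PiE)
qed (auto simp: inj_on_def intro: poly_mapping_eqI)

lemma finite_subset_terms_upto:
  assumes "finite (S :: 'n::finite pterm set)"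
  obtains d where "S \<subseteq> terms_upto d"
proof (rule that)
  show "S \<subseteq> terms_upto (Max (tdeg ` S))" using assms by auto
qed

lemma tdvd_refl [simp]: "tdvd t t"
  unfolding tdvd_def by (rule exI[of _ 0]) simp

lemma tdvd_trans: "tdvd s t \<Longrightarrow> tdvd t u \<Longrightarrow> tdvd s u"
  unfolding tdvd_def by (metis add.assoc)

lemma tdvd_tdeg: "tdvd s t \<Longrightarrow> tdeg s \<le> tdeg t"
  by (auto simp: tdvd_def tdeg_add)

lemma order_ideal_span_superset: "S \<subseteq> order_ideal_span S"
  by (auto simp: order_ideal_span_def intro: tdvd_refl)

lemma order_ideal_order_ideal_span: "order_ideal (order_ideal_span S)"
  by (auto simp: order_ideal_span_def order_ideal_def intro: tdvd_trans)

lemma finite_order_ideal_span: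
  assumes "finite (S :: 'n::finite pterm set)"
  shows "finite (order_ideal_span S)"
proof -
  obtain d where "S \<subseteq> terms_upto d" using assms by (rule finite_subset_terms_upto)
  then have "order_ideal_span S \<subseteq> terms_upto d"
    by (auto simp: order_ideal_span_def dest!: tdvd_tdeg)
  then show ?thesis by (rule finite_subset) simp
qed

lemma order_ideal_tvar:
  assumes "order_ideal U" and "tvar i + t \<in> U"
  shows "t \<in> U"
  using assms unfolding order_ideal_def tdvd_def by (metis add.commute)

lemma order_ideal_zero_mem: "order_ideal U \<Longrightarrow> U \<noteq> {} \<Longrightarrow> 0 \<in> U"
  unfolding order_ideal_def tdvd_def by (metis add_0 all_not_in_conv)

lemma tplus_superset: "S \<subseteq> tplus S"
  by (simp add: tplus_def)

lemma tvar_add_mem_tplus: "t \<in> S \<Longrightarrow> tvar i + t \<in> tplus S"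
  by (auto simp: tplus_def)

lemma finite_tplus: "finite S \<Longrightarrow> finite (tplus (S :: 'n::finite pterm set))"
  by (simp add: tplus_def)

lemma order_ideal_tplus:
  assumes U: "order_ideal U"
  shows "order_ideal (tplus U)"
  unfolding order_ideal_def
proof (intro ballI allI impI)
  fix t' s assume t': "t' \<in> tplus U" and "tdvd s t'"
  then obtain r where r: "t' = s + r" by (auto simp: tdvd_def)
  show "s \<in> tplus U"
  proof (cases "t' \<in> U")
    case True
    then have "s \<in> U" using U \<open>tdvd s t'\<close> by (auto simp: order_ideal_def)
    then show ?thesis using tplus_superset by auto
  next
    case False
    then obtain i u where u: "u \<in> U" "t' = tvar i + u" using t' by (auto simp: tplus_def)
    show ?thesis
    proof (cases "Poly_Mapping.lookup r i = 0")
      case True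
      \<comment> \<open>then \<open>x\<^sub>i\<close> divides \<open>s\<close>, and \<open>s / x\<^sub>i\<close> divides \<open>u\<close>\<close>
      have si: "Poly_Mapping.lookup s i \<noteq> 0"
        using True r u(2)
        by (metis add.right_neutral add_is_0 lookup_add lookup_single_eq tvar_def zero_neq_one)
      have s: "s = tvar i + (s - tvar i)"
        using si by (intro poly_mapping_eqI)
          (auto simp: tvar_def lookup_add lookup_minus lookup_single when_def)
      then have "u = (s - tvar i) + r"
        using r u(2) by (metis add.assoc add_left_cancel)
      then have "s - tvar i \<in> U" using U u(1) by (auto simp: order_ideal_def tdvd_def)
      then show ?thesis using s tvar_add_mem_tplus by metis
    next
      case False
      have "r = tvar i + (r - tvar i)"
        using False by (intro poly_mapping_eqI)
          (auto simp: tvar_def lookup_add lookup_minus lookup_single when_def)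
      then have "u = s + (r - tvar i)"
        using r u(2) by (metis add.left_commute add_left_cancel)
      then have "s \<in> U" using U u(1) by (auto simp: order_ideal_def tdvd_def)
      then show ?thesis using tplus_superset by auto
    qed
  qed
qed

section \<open>Polynomials\<close>

lemma coeff_pscale [simp]: "coeff (pscale c f) t = c * coeff f t"
  by (simp add: pscale_def flip: mult_map_scale_conv_mult) (simp add: map.rep_eq when_def)

lemma pscale_monomial [simp]: "pscale c (monomial d t) = monomial (c * d) t"
  by (simp add: pscale_def mult_single)

lemma coeff_monomial_times:
  "coeff (monomial c s * f) (s + t) = (c * coeff f t :: 'k::field)"
proof -
  have "coeff (monomial c s * f) (s + t) =
      Sum_any (\<lambda>l. (c when s = l) * Sum_any (\<lambda>q. coeff f q when s + t = l + q))"
    by (simp add: lookup_mult lookup_single)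
  also have "\<dots> = Sum_any (\<lambda>l. c * Sum_any (\<lambda>q. coeff f q when s + t = l + q) when s = l)"
    by (simp add: when_mult)
  also have "\<dots> = c * Sum_any (\<lambda>q. coeff f q when s + t = s + q)"
    by simp
  finally show ?thesis by simp
qed

lemma coeff_pvar_times [simp]: "coeff (pvar i * f) (tvar i + t) = coeff f t"
  by (simp add: pvar_def coeff_monomial_times)

lemma supp_pvar_times: "supp (pvar i * f) = (\<lambda>t. tvar i + t) ` supp (f :: ('n, 'k::field) mpoly)"
proof -
  have "supp (pvar i * f) \<subseteq> (\<lambda>t. tvar i + t) ` supp f"
    using keys_mult[of "pvar i" f] by (auto simp: pvar_def)
  then show ?thesis by (auto simp: in_keys_iff)
qed

lemma pvar_times_monomial: "pvar i * monomial c t = monomial c (tvar i + t)"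
  by (simp add: pvar_def mult_single)

lemma pvar_times_pscale: "pvar i * pscale c f = pscale c (pvar i * f)"
  by (simp add: pscale_def mult.left_commute)

lemma pvar_times_sum: "pvar i * (\<Sum>x\<in>A. f x) = (\<Sum>x\<in>A. pvar i * f x)"
  by (rule sum_distrib_left)

lemma poly_eq_sum_monomials:
  assumes "finite S" and "supp f \<subseteq> S"
  shows "f = (\<Sum>t\<in>S. monomial (coeff f t) t)"
proof (rule poly_mapping_eqI)
  fix u
  have "(\<Sum>t\<in>S. coeff (monomial (coeff f t) t) u) = (\<Sum>t\<in>S. if t = u then coeff f t else 0)"
    by (intro sum.cong) (auto simp: lookup_single when_def)
  also have "\<dots> = coeff f u"
    using assms by (auto simp: in_keys_iff)
  finally show "coeff f u = coeff (\<Sum>t\<in>S. monomial (coeff f t) t) u"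
    by (simp add: lookup_sum)
qed

lemma coeff_sum_monomials:
  assumes "finite S"
  shows "coeff (\<Sum>t\<in>S. monomial (c t) t) u = (if u \<in> S then c u else 0)"
proof -
  have "coeff (\<Sum>t\<in>S. monomial (c t) t) u = (\<Sum>t\<in>S. if t = u then c t else 0)"
    unfolding lookup_sum by (intro sum.cong) (auto simp: lookup_single when_def)
  then show ?thesis using assms by simp
qed

lemma subspace_supp: "Kvs.subspace {f :: ('n, 'k::field) mpoly. supp f \<subseteq> S}"
  by (rule Kvs.subspaceI) (auto simp: in_keys_iff lookup_add subset_iff, metis add.right_neutral)

lemma supp_span:
  assumes "f \<in> Kspan V"
  shows "supp f \<subseteq> (\<Union>v\<in>V. supp v)"
  using Kvs.span_minimal[OF _ subspace_supp, of V "\<Union>v\<in>V. supp v"] assms by blast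

lemma pplus_superset: "V \<subseteq> pplus V"
  by (simp add: pplus_def)

lemma pvar_times_mem_pplus: "v \<in> V \<Longrightarrow> pvar i * v \<in> pplus V"
  by (auto simp: pplus_def)

lemma finite_pplus: "finite V \<Longrightarrow> finite (pplus (V :: ('n::finite, 'k::field) mpoly set))"
  by (simp add: pplus_def)

lemma subspace_ideal_of: "Kvs.subspace (ideal_of F)"
  by (rule Kvs.subspaceI)
    (auto simp: pscale_def Pmod.span_zero Pmod.span_add intro!: Pmod.span_scale)

text \<open>Multiplying by \<open>x\<^sub>i\<close> is linear, so it maps the span of \<open>V\<close> into the span of the products.\<close>

lemma pvar_times_mem_span_pplus:
  assumes "f \<in> Kspan V"
  shows "pvar i * f \<in> Kspan (pplus V)"
proof -
  have "Kvs.subspace {f. pvar i * f \<in> Kspan (pplus V)}"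
    by (rule Kvs.subspaceI)
      (auto simp: distrib_left pvar_times_pscale
        intro: Kvs.span_zero Kvs.span_add Kvs.span_scale)
  with assms show ?thesis
    using Kvs.span_minimal[of V "{f. pvar i * f \<in> Kspan (pplus V)}"]
    by (auto intro: Kvs.span_base pvar_times_mem_pplus)
qed

text \<open>
  Every polynomial is a \<open>K\<close>-combination of products of indeterminates, so a \<open>K\<close>-subspace is an
  ideal as soon as it is closed under multiplication by the indeterminates.  This reduces statements
  about ideals to linear algebra plus one multiplication at a time.
\<close>

lemma ideal_of_least:
  fixes S :: "('n::finite, 'k::field) mpoly set"
  assumes S: "Kvs.subspace S" and "F \<subseteq> S"
    and pvar: "\<And>i f. f \<in> S \<Longrightarrow> pvar i * f \<in> S"
  shows "ideal_of F \<subseteq> S"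
proof (rule Pmod.span_minimal[OF \<open>F \<subseteq> S\<close>])
  have mono: "monomial 1 t * f \<in> S" if "f \<in> S" for t :: "'n pterm" and f
  proof (induction "tdeg t" arbitrary: t)
    case 0
    then show ?case using that by simp
  next
    case (Suc d)
    then obtain i t' where t: "t = tvar i + t'" by (metis pterm_neq_0E nat.distinct(1) tdeg_zero)
    with Suc have "monomial 1 t' * f \<in> S" by simp
    from pvar[OF this, of i] show ?case
      by (simp add: t pvar_def mult_single flip: mult.assoc)
  qed
  show "Pmod.subspace S"
  proof (rule Pmod.subspaceI)
    fix c f :: "('n, 'k) mpoly" assume f: "f \<in> S"
    have c: "c = (\<Sum>t\<in>supp c. pscale (coeff c t) (monomial 1 t))"
      unfolding pscale_monomial mult_1_right by (rule poly_eq_sum_monomials) auto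
    have "c * f = (\<Sum>t\<in>supp c. pscale (coeff c t) (monomial 1 t)) * f"
      using c by (rule arg_cong)
    also have "\<dots> = (\<Sum>t\<in>supp c. pscale (coeff c t) (monomial 1 t * f))"
      unfolding sum_distrib_right pscale_def mult.assoc ..
    also have "\<dots> \<in> S"
      by (intro Kvs.subspace_sum[OF S] Kvs.subspace_scale[OF S] mono f)
    finally show "c * f \<in> S" .
  qed (use S in \<open>auto intro: Kvs.subspace_0 Kvs.subspace_add\<close>)
qed

lemma pvar_times_mem_ideal_of: "f \<in> ideal_of F \<Longrightarrow> pvar i * f \<in> ideal_of F"
  by (rule Pmod.span_scale)

lemma Kspan_subset_ideal_of: "V \<subseteq> ideal_of F \<Longrightarrow> Kspan V \<subseteq> ideal_of F"
  by (rule Kvs.span_minimal) (auto intro: subspace_ideal_of)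

section \<open>Reduced sets of marked polynomials\<close>

lemma tdeg_le_marked:
  assumes "is_marking V mt" and "v \<in> V" and "t \<in> supp v"
  shows "tdeg t \<le> tdeg (mt v)"
  using assms by (simp add: is_marking_def pdeg_def)

lemma is_markingI:
  assumes "\<And>v. v \<in> V \<Longrightarrow> mt v \<in> supp v"
    and "\<And>v t. v \<in> V \<Longrightarrow> t \<in> supp v \<Longrightarrow> tdeg t \<le> tdeg (mt v)"
  shows "is_marking V mt"
  unfolding is_marking_def pdeg_def using assms
  by (fastforce intro!: Max_eqI[symmetric])

text \<open>
  The shape of the output of an interreduction: the marked terms behave like the pivots of a reduced
  row echelon form, although the pivots need not be leading with respect to any term ordering.
\<close>

definition marked_reduced ::
    "('n::finite, 'k::field) mpoly set \<Rightarrow> (('n, 'k) mpoly \<Rightarrow> 'n pterm) \<Rightarrow> bool"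
  where "marked_reduced V mt \<longleftrightarrow> finite V \<and> is_marking V mt \<and>
    (\<forall>v\<in>V. coeff v (mt v) = 1) \<and> (\<forall>v\<in>V. \<forall>w\<in>V. v \<noteq> w \<longrightarrow> mt v \<notin> supp w)"

lemma marked_reduced_finite: "marked_reduced V mt \<Longrightarrow> finite V"
  by (simp add: marked_reduced_def)

lemma marked_reduced_mem_supp: "marked_reduced V mt \<Longrightarrow> v \<in> V \<Longrightarrow> mt v \<in> supp v"
  by (simp add: marked_reduced_def is_marking_def)

lemma marked_reduced_subset: "marked_reduced V mt \<Longrightarrow> W \<subseteq> V \<Longrightarrow> marked_reduced W mt"
  unfolding marked_reduced_def is_marking_def
  by (blast intro: finite_subset)

lemma marked_reduced_cong:
  "marked_reduced V mt \<Longrightarrow> (\<And>v. v \<in> V \<Longrightarrow> mt' v = mt v) \<Longrightarrow> marked_reduced V mt'"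
  by (auto simp: marked_reduced_def is_marking_def)

lemma marked_reduced_inj_on: "marked_reduced V mt \<Longrightarrow> inj_on mt V"
  unfolding inj_on_def by (metis marked_reduced_def is_marking_def)

lemma coeff_marked:
  assumes "marked_reduced V mt" and "v \<in> V" and "w \<in> V"
  shows "coeff v (mt w) = (if v = w then 1 else 0)"
  using assms by (auto simp: marked_reduced_def in_keys_iff)

text \<open>
  For reduced \<open>V\<close> this is the projection along the span of \<open>V\<close> onto the polynomials without marked
  terms.  One subtraction suffices because cancelling a marked term introduces no other one.
\<close>

definition marked_remainder ::
    "('n, 'k::field) mpoly set \<Rightarrow> (('n, 'k) mpoly \<Rightarrow> 'n pterm) \<Rightarrow> ('n, 'k) mpoly \<Rightarrow> ('n, 'k) mpoly"
  where "marked_remainder V mt f = f - (\<Sum>v\<in>V. pscale (coeff f (mt v)) v)"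

lemma marked_remainder_add:
  "marked_remainder V mt (f + g) = marked_remainder V mt f + marked_remainder V mt g"
  by (simp add: marked_remainder_def lookup_add Kvs.scale_left_distrib sum.distrib)

lemma marked_remainder_pscale:
  "marked_remainder V mt (pscale c f) = pscale c (marked_remainder V mt f)"
  by (simp add: marked_remainder_def Kvs.scale_right_diff_distrib Kvs.scale_sum_right)

lemma marked_remainder_0 [simp]: "marked_remainder V mt 0 = 0"
  by (simp add: marked_remainder_def)

lemma marked_remainder_diff:
  "marked_remainder V mt (f - g) = marked_remainder V mt f - marked_remainder V mt g"
  by (simp add: marked_remainder_def lookup_minus Kvs.scale_left_diff_distrib sum_subtractf)

lemma diff_marked_remainder_mem_span: "f - marked_remainder V mt f \<in> Kspan V"
  by (simp add: marked_remainder_def Kvs.span_sum Kvs.span_scale Kvs.span_base)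

lemma coeff_sum_marked:
  assumes "marked_reduced V mt" and "w \<in> V"
  shows "coeff (\<Sum>v\<in>V. pscale (c v) v) (mt w) = c w"
proof -
  have "coeff (\<Sum>v\<in>V. pscale (c v) v) (mt w) = (\<Sum>v\<in>V. if v = w then c v else 0)"
    unfolding lookup_sum by (intro sum.cong) (auto simp: coeff_marked[OF assms(1) _ assms(2)])
  then show ?thesis using assms by (simp add: marked_reduced_finite)
qed

lemma coeff_marked_remainder:
  "marked_reduced V mt \<Longrightarrow> w \<in> V \<Longrightarrow> coeff (marked_remainder V mt f) (mt w) = 0"
  using coeff_sum_marked[where c = "\<lambda>v. coeff f (mt v)"]
  by (simp add: marked_remainder_def lookup_minus)

lemma marked_remainder_eq_0_iff:
  assumes "marked_reduced V mt"
  shows "marked_remainder V mt f = 0 \<longleftrightarrow> f \<in> Kspan V"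
proof
  assume "marked_remainder V mt f = 0"
  then show "f \<in> Kspan V" using diff_marked_remainder_mem_span[of f V mt] by simp
next
  assume "f \<in> Kspan V"
  then obtain c where f: "f = (\<Sum>v\<in>V. pscale (c v) v)"
    using marked_reduced_finite[OF assms] by (auto simp: Kvs.span_finite)
  have "(\<Sum>v\<in>V. pscale (coeff f (mt v)) v) = f"
    unfolding f by (intro sum.cong) (simp_all add: coeff_sum_marked[OF assms])
  then show "marked_remainder V mt f = 0" by (simp add: marked_remainder_def)
qed

text \<open>
  Because every marked term occurs in one element only, the coordinates of an element of the span
  can be read off from its marked terms.
\<close>

lemma marked_reduced_expansion:
  assumes "marked_reduced V mt" and "f \<in> Kspan V"
  shows "f = (\<Sum>v\<in>V. pscale (coeff f (mt v)) v)"
  using marked_remainder_eq_0_iff[OF assms(1), of f] assms(2) by (simp add: marked_remainder_def)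

lemma marked_reduced_mem_spanI:
  assumes red: "marked_reduced V mt" and f: "f \<in> Kspan V"
    and W: "\<And>v. v \<in> V \<Longrightarrow> mt v \<in> supp f \<Longrightarrow> v \<in> Kspan W"
  shows "f \<in> Kspan W"
proof -
  have "pscale (coeff f (mt v)) v \<in> Kspan W" if "v \<in> V" for v
    using W[OF that] by (cases "mt v \<in> supp f")
      (auto simp: in_keys_iff intro: Kvs.span_scale Kvs.span_zero)
  then show ?thesis
    using marked_reduced_expansion[OF red f] by (metis (mono_tags, lifting) Kvs.span_sum)
qed

lemma marked_reduced_independent:
  assumes "marked_reduced V mt"
  shows "Kvs.independent V"
  unfolding Kvs.dependent_finite[OF marked_reduced_finite[OF assms]]
proof (clarify)
  fix c v assume "v \<in> V" "c v \<noteq> 0" "(\<Sum>v\<in>V. pscale (c v) v) = 0"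
  then show False using coeff_sum_marked[OF assms, of v c] by simp
qed

lemma supp_marked_remainder:
  assumes red: "marked_reduced V mt" and "(\<Union>v\<in>V. supp v) \<subseteq> U" and "supp f \<subseteq> U"
  shows "supp (marked_remainder V mt f) \<subseteq> U - mt ` V"
proof -
  have "f \<in> {f. supp f \<subseteq> U}" using assms by simp
  moreover have "(\<Sum>v\<in>V. pscale (coeff f (mt v)) v) \<in> {f. supp f \<subseteq> U}"
    by (rule Kvs.subspace_sum[OF subspace_supp], rule Kvs.subspace_scale[OF subspace_supp])
      (use assms(2) in auto)
  ultimately have "marked_remainder V mt f \<in> {f. supp f \<subseteq> U}"
    unfolding marked_remainder_def by (rule Kvs.subspace_diff[OF subspace_supp])
  moreover have "mt v \<notin> supp (marked_remainder V mt f)" if "v \<in> V" for v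
    using coeff_marked_remainder[OF red that] by (simp add: in_keys_iff)
  ultimately show ?thesis by auto
qed

lemma marked_remainder_cong_unmarked:
  assumes "\<And>v. v \<in> V \<Longrightarrow> mt v \<notin> supp f"
  shows "marked_remainder V mt f = f"
  using assms by (simp add: marked_remainder_def in_keys_iff)

section \<open>Marked Interreduction\<close>

definition matrix_row ::
    "'n pterm list \<Rightarrow> (nat \<Rightarrow> nat \<Rightarrow> 'k::field) \<Rightarrow> nat \<Rightarrow> ('n, 'k) mpoly"
  where "matrix_row ts a i = (\<Sum>j<length ts. monomial (a i j) (ts ! j))"

lemma coeff_matrix_row:
  assumes "distinct ts" and "j < length ts"
  shows "coeff (matrix_row ts a i) (ts ! j) = a i j"
proof -
  have "coeff (matrix_row ts a i) (ts ! j) = (\<Sum>j'<length ts. if j' = j then a i j' else 0)"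
    unfolding matrix_row_def lookup_sum
    using assms by (intro sum.cong) (auto simp: lookup_single when_def nth_eq_iff_index_eq)
  then show ?thesis using assms by simp
qed

lemma supp_matrix_row: "supp (matrix_row ts a i) \<subseteq> set ts"
proof
  fix t assume "t \<in> supp (matrix_row ts a i)"
  then have "(\<Sum>j<length ts. coeff (monomial (a i j) (ts ! j)) t) \<noteq> 0"
    by (simp add: in_keys_iff matrix_row_def lookup_sum)
  then obtain j where "j < length ts" "coeff (monomial (a i j) (ts ! j)) t \<noteq> 0"
    by (metis (no_types, lifting) lessThan_iff sum.neutral)
  then show "t \<in> set ts" by (auto simp: lookup_single when_def split: if_splits)
qed

lemma matrix_row_eq_0_iff:
  assumes "distinct ts"
  shows "matrix_row ts a i = 0 \<longleftrightarrow> (\<forall>j<length ts. a i j = 0)"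
proof
  assume "matrix_row ts a i = 0"
  then show "\<forall>j<length ts. a i j = 0" using coeff_matrix_row[OF assms, of _ a i] by simp
qed (simp add: matrix_row_def)

lemma matrix_row_coeffs:
  assumes "distinct ts" and "supp (fs ! i) \<subseteq> set ts"
  shows "matrix_row ts (\<lambda>i j. coeff (fs ! i) (ts ! j)) i = fs ! i"
proof -
  have "matrix_row ts (\<lambda>i j. coeff (fs ! i) (ts ! j)) i =
      (\<Sum>t\<in>set ts. monomial (coeff (fs ! i) t) t)"
    unfolding matrix_row_def using assms(1)
    by (intro sum.reindex_bij_betw[of "(!) ts" "{..<length ts}" "set ts"
          "\<lambda>t. monomial (coeff (fs ! i) t) t"]) (simp add: bij_betw_nth)
  also have "\<dots> = fs ! i"
    using assms(2) by (intro poly_eq_sum_monomials[symmetric]) auto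
  finally show ?thesis .
qed

text \<open>
  The loop invariant, with \<open>d j\<close> standing for the degree of the term of column \<open>j\<close> and \<open>i\<close> for the
  number of rows treated.  That pivots have maximal degree in their rows prevents a row operation from
  raising the degree of a row: row \<open>i\<close> is subtracted only from rows in which its pivot occurs.  The last
  part says that the pivot columns of the rows treated are unit vectors.
\<close>

definition interreduction_inv ::
    "nat \<Rightarrow> nat \<Rightarrow> (nat \<Rightarrow> nat) \<Rightarrow> nat \<Rightarrow> (nat \<Rightarrow> nat \<Rightarrow> 'k::field) \<Rightarrow> (nat \<Rightarrow> nat) \<Rightarrow> bool"
  where "interreduction_inv s l d i a p \<longleftrightarrow>
    (\<forall>r<s. p r < l) \<and>
    (\<forall>r<s. (\<exists>j<l. a r j \<noteq> 0) \<longrightarrow> a r (p r) \<noteq> 0 \<and> (\<forall>j<l. a r j \<noteq> 0 \<longrightarrow> d j \<le> d (p r))) \<and>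
    (\<forall>r<i. (\<exists>j<l. a r j \<noteq> 0) \<longrightarrow> a r (p r) = 1 \<and> (\<forall>r'<s. r' \<noteq> r \<longrightarrow> a r' (p r) = 0))"

text \<open>
  A zero row is not normalised, but subtracting it changes nothing inside the matrix, so both cases are
  covered by the same equations; the factor \<open>c\<^sub>i\<close> is the inverse of the pivot entry or 1.
\<close>

lemma interreduction_step_entries:
  assumes step: "interreduction_step s l i (a, p) = (a', p')"
    and i: "i < s" and piv: "p i < l" and nz: "(\<exists>j<l. a i j \<noteq> 0) \<Longrightarrow> a i (p i) \<noteq> 0"
  obtains c c\<^sub>i where
    "\<And>j. j < l \<Longrightarrow> a' i j = c\<^sub>i * a i j" "c\<^sub>i \<noteq> 0" "c\<^sub>i * a i (p i) = (if \<exists>j<l. a i j \<noteq> 0 then 1 else 0)"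
    "\<And>k j. k < s \<Longrightarrow> k \<noteq> i \<Longrightarrow> j < l \<Longrightarrow> a' k j = a k j - c k * a' i j"
    "\<And>k. k < s \<Longrightarrow> k \<noteq> i \<Longrightarrow> c k = a k (p i)"
    "p' = (\<lambda>k. if i < k \<and> k < s \<and> a' k (p k) = 0 \<and> (\<exists>j<l. a' k j \<noteq> 0)
               then (LEAST j. j < l \<and> a' k j \<noteq> 0) else p k)"
proof (rule that)
  let ?ci = "if a i (p i) \<noteq> 0 then inverse (a i (p i)) else 1"
  define a1 where "a1 = (if a i (p i) \<noteq> 0 then a(i := (\<lambda>j. inverse (a i (p i)) * a i j)) else a)"
  have a': "a' = (\<lambda>k. if k < s \<and> k \<noteq> i \<and> a1 k (p i) \<noteq> 0
                       then (\<lambda>j. a1 k j - a1 k (p i) * a1 i j) else a1 k)"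
    and p': "p' = (\<lambda>k. if i < k \<and> k < s \<and> a' k (p k) = 0 \<and> (\<exists>j<l. a' k j \<noteq> 0)
               then (LEAST j. j < l \<and> a' k j \<noteq> 0) else p k)"
    using step unfolding interreduction_step_def Let_def a1_def by auto
  show "p' = (\<lambda>k. if i < k \<and> k < s \<and> a' k (p k) = 0 \<and> (\<exists>j<l. a' k j \<noteq> 0)
               then (LEAST j. j < l \<and> a' k j \<noteq> 0) else p k)" by (rule p')
  show "a' i j = ?ci * a i j" for j by (simp add: a' a1_def)
  show "?ci \<noteq> 0" by simp
  show "?ci * a i (p i) = (if \<exists>j<l. a i j \<noteq> 0 then 1 else 0)"
    using nz piv by auto
  show "a' k j = a k j - a k (p i) * a' i j" if "k < s" "k \<noteq> i" for k j
    using that by (simp add: a' a1_def)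
qed simp

lemma interreduction_inv_step:
  assumes inv: "interreduction_inv s l d i a p" and i: "i < s"
    and d: "\<And>j j'. j \<le> j' \<Longrightarrow> j' < l \<Longrightarrow> d j' \<le> d j"
    and step: "interreduction_step s l i (a, p) = (a', p')"
  shows "interreduction_inv s l d (Suc i) a' p'"
proof -
  have pl: "p r < l" if "r < s" for r
    using inv that by (simp add: interreduction_inv_def)
  have piv: "a r (p r) \<noteq> 0" "\<And>j. j < l \<Longrightarrow> a r j \<noteq> 0 \<Longrightarrow> d j \<le> d (p r)"
    if "r < s" "j < l" "a r j \<noteq> 0" for r j
    using inv that by (auto simp: interreduction_inv_def)
  have pivi: "a i (p i) \<noteq> 0" if "\<exists>j<l. a i j \<noteq> 0" using piv(1)[OF i] that by blast
  have unit: "a r (p r) = 1" "\<And>r'. r' < s \<Longrightarrow> r' \<noteq> r \<Longrightarrow> a r' (p r) = 0"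
    if "r < i" "j < l" "a r j \<noteq> 0" for r j
    using inv that by (auto simp: interreduction_inv_def)
  obtain c c\<^sub>i where ai: "\<And>j. j < l \<Longrightarrow> a' i j = c\<^sub>i * a i j" and ci: "c\<^sub>i \<noteq> 0"
    and ci': "c\<^sub>i * a i (p i) = (if \<exists>j<l. a i j \<noteq> 0 then 1 else 0)"
    and ak: "\<And>k j. k < s \<Longrightarrow> k \<noteq> i \<Longrightarrow> j < l \<Longrightarrow> a' k j = a k j - c k * a' i j"
    and c: "\<And>k. k < s \<Longrightarrow> k \<noteq> i \<Longrightarrow> c k = a k (p i)"
    and p': "p' = (\<lambda>k. if i < k \<and> k < s \<and> a' k (p k) = 0 \<and> (\<exists>j<l. a' k j \<noteq> 0)
               then (LEAST j. j < l \<and> a' k j \<noteq> 0) else p k)"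
    by (rule interreduction_step_entries[OF step i pl[OF i] pivi]) blast+
  have p'_le: "p' r = p r" if "r \<le> i" for r using that by (simp add: p')
  \<comment> \<open>zero rows stay zero\<close>
  have nz: "\<exists>j<l. a r j \<noteq> 0" if "r < s" "j < l" "a' r j \<noteq> 0" for r j
  proof (cases "r = i")
    case True
    then show ?thesis using that ai by auto
  next
    case False
    show ?thesis
    proof (rule ccontr)
      assume "\<not> (\<exists>j<l. a r j \<noteq> 0)"
      then have "a r j = 0" "a r (p i) = 0" using that pl[OF i] by auto
      then show False using that False ak c by simp
    qed
  qed
  \<comment> \<open>degrees of rows do not grow: the multiple of row \<open>i\<close> is nonzero only if column \<open>p i\<close> occurs
      in row \<open>r\<close>, and row \<open>i\<close> has the degree of that column\<close>
  have deg: "d j \<le> d (p r)" if "r < s" "j < l" "a' r j \<noteq> 0" for r j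
  proof -
    from nz[OF that] obtain j0 where j0: "j0 < l" "a r j0 \<noteq> 0" by auto
    show ?thesis
    proof (cases "a r j \<noteq> 0")
      case True
      then show ?thesis using piv(2)[OF that(1) j0] that by simp
    next
      case False
      then have ri: "r \<noteq> i" using that ai by auto
      then have "a r (p i) \<noteq> 0" "a i j \<noteq> 0"
        using that False ak[of r j] c[of r] ai[of j] by auto
      then have "d j \<le> d (p i)" "d (p i) \<le> d (p r)"
        using piv(2)[OF i \<open>j < l\<close>] piv(2)[OF that(1) j0] pl[OF i] that by auto
      then show ?thesis by simp
    qed
  qed
  have treated: "a' r (p r) = 1 \<and> (\<forall>r'<s. r' \<noteq> r \<longrightarrow> a' r' (p r) = 0)"
    if r: "r < Suc i" and j: "j < l" "a' r j \<noteq> 0" for r j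
  proof -
    have rs: "r < s" using r i by simp
    obtain j0 where j0: "j0 < l" "a r j0 \<noteq> 0" using nz[OF rs j] by auto
    show ?thesis
    proof (cases "r = i")
      case True
      have "a' i (p i) = 1" using ai[of "p i"] ci' j0 pl[OF i] by (auto simp: True)
      then show ?thesis using ak[OF _ _ pl[OF i]] c by (simp add: True)
    next
      case False
      then have ri: "r < i" using r by simp
      have "a i (p r) = 0" using unit(2)[OF ri j0 i] ri by simp
      then have zi: "a' i (p r) = 0" using ai[OF pl[OF rs]] by simp
      have "a' r (p r) = 1" using ak[OF rs False pl[OF rs]] zi unit(1)[OF ri j0] by simp
      moreover have "a' r' (p r) = 0" if "r' < s" "r' \<noteq> r" for r'
        using ak[OF that(1) _ pl[OF rs]] zi unit(2)[OF ri j0 that] by (cases "r' = i") auto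
      ultimately show ?thesis by simp
    qed
  qed
  have pivots: "p' r < l \<and> ((\<exists>j<l. a' r j \<noteq> 0) \<longrightarrow>
      a' r (p' r) \<noteq> 0 \<and> (\<forall>j<l. a' r j \<noteq> 0 \<longrightarrow> d j \<le> d (p' r)))" if r: "r < s" for r
  proof (cases "i < r \<and> a' r (p r) = 0 \<and> (\<exists>j<l. a' r j \<noteq> 0)")
    case True
    \<comment> \<open>the new pivot is the first nonzero column, and the columns are ordered by decreasing degree\<close>
    let ?P = "\<lambda>j. j < l \<and> a' r j \<noteq> 0"
    have new: "p' r = (LEAST j. ?P j)" using True r by (simp add: p')
    have "?P (p' r)" unfolding new by (rule LeastI_ex) (use True in blast)
    moreover have "p' r \<le> j" if "?P j" for j unfolding new using that by (rule Least_le)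
    ultimately show ?thesis using d by blast
  next
    case False
    then have same: "p' r = p r" by (auto simp: p')
    have "a' r (p r) \<noteq> 0" if "j < l" "a' r j \<noteq> 0" for j
    proof (cases "i < r")
      case True
      then show ?thesis using False that by auto
    next
      case False
      then show ?thesis using treated[of r j] that by simp
    qed
    then show ?thesis using same pl[OF r] deg[OF r] by auto
  qed
  show ?thesis unfolding interreduction_inv_def
    using pivots treated p'_le by (auto simp: less_Suc_eq_le)
qed

text \<open>
  Rows that are already reduced with respect to each other do not change each other; later rows are
  cleared of their pivot columns before they are used.  So they keep their pivots.
\<close>

lemma interreduction_step_keeps_pivots:
  assumes inv: "interreduction_inv s l d i a p" and i: "i < s" and k: "k \<le> s"
    and keep: "\<forall>r<k. p r = p\<^sub>0 r \<and> a r (p\<^sub>0 r) \<noteq> 0 \<and> (\<forall>r'<k. r' \<noteq> r \<longrightarrow> a r' (p\<^sub>0 r) = 0)"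
    and step: "interreduction_step s l i (a, p) = (a', p')"
  shows "\<forall>r<k. p' r = p\<^sub>0 r \<and> a' r (p\<^sub>0 r) \<noteq> 0 \<and> (\<forall>r'<k. r' \<noteq> r \<longrightarrow> a' r' (p\<^sub>0 r) = 0)"
proof -
  have pl: "p r < l" if "r < s" for r
    using inv that by (simp add: interreduction_inv_def)
  have piv: "a i (p i) \<noteq> 0" if "\<exists>j<l. a i j \<noteq> 0"
    using inv i that by (auto simp: interreduction_inv_def)
  obtain c c\<^sub>i where ai: "\<And>j. j < l \<Longrightarrow> a' i j = c\<^sub>i * a i j" and ci: "c\<^sub>i \<noteq> 0"
    and ak: "\<And>k j. k < s \<Longrightarrow> k \<noteq> i \<Longrightarrow> j < l \<Longrightarrow> a' k j = a k j - c k * a' i j"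
    and c: "\<And>k. k < s \<Longrightarrow> k \<noteq> i \<Longrightarrow> c k = a k (p i)"
    and p': "p' = (\<lambda>k. if i < k \<and> k < s \<and> a' k (p k) = 0 \<and> (\<exists>j<l. a' k j \<noteq> 0)
               then (LEAST j. j < l \<and> a' k j \<noteq> 0) else p k)"
    by (rule interreduction_step_entries[OF step i pl[OF i] piv]) blast+
  have p0: "p r = p\<^sub>0 r" "a r (p r) \<noteq> 0" "\<And>r'. r' < k \<Longrightarrow> r' \<noteq> r \<Longrightarrow> a r' (p r) = 0"
    if "r < k" for r
    using keep that by auto
  have mult: "\<exists>e. (e = 0 \<longleftrightarrow> a r' (p r) = 0) \<and> a' r' (p r) = e" if r: "r < k" "r' < k" for r r'
  proof (cases "r' = i")
    case True
    then show ?thesis using ai[OF pl, of r] ci r k by auto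
  next
    case False
    have rs: "r < s" "r' < s" using r k by auto
    have "c r' * a' i (p r) = 0"
    proof (cases "i < k")
      case True
      then show ?thesis using p0(3)[OF True r(2) False] c[OF rs(2) False] by simp
    next
      case False
      then have "r < i" using r by simp
      moreover have "\<exists>j<l. a r j \<noteq> 0" using p0(2)[OF r(1)] pl[OF rs(1)] by auto
      ultimately have "a i (p r) = 0" using inv i by (auto simp: interreduction_inv_def)
      then show ?thesis using ai[OF pl[OF rs(1)]] by simp
    qed
    then have "a' r' (p r) = a r' (p r)"
      using ak[OF rs(2) False pl[OF rs(1)]] by (metis diff_zero)
    then show ?thesis by simp
  qed
  then have zero_iff: "a' r' (p r) = 0 \<longleftrightarrow> a r' (p r) = 0" if "r < k" "r' < k" for r r'
    using that by blast
  moreover have "p' r = p r" if "r < k" for r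
    using zero_iff[OF that that] p0(2)[OF that] by (simp add: p')
  ultimately show ?thesis using p0 by metis
qed

lemma interreduction_step_span:
  assumes inv: "interreduction_inv s (length ts) d i a p" and i: "i < s"
    and step: "interreduction_step s (length ts) i (a, p) = (a', p')"
  shows "Kspan (matrix_row ts a' ` {..<s}) = Kspan (matrix_row ts a ` {..<s})"
proof -
  let ?row = "matrix_row ts"
  have pl: "p i < length ts" and piv: "(\<exists>j<length ts. a i j \<noteq> 0) \<Longrightarrow> a i (p i) \<noteq> 0"
    using inv i by (auto simp: interreduction_inv_def)
  obtain c c\<^sub>i where ai: "\<And>j. j < length ts \<Longrightarrow> a' i j = c\<^sub>i * a i j" and ci: "c\<^sub>i \<noteq> 0"
    and ak: "\<And>k j. k < s \<Longrightarrow> k \<noteq> i \<Longrightarrow> j < length ts \<Longrightarrow> a' k j = a k j - c k * a' i j"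
    by (rule interreduction_step_entries[OF step i pl piv]) blast+
  have rowi: "?row a' i = pscale c\<^sub>i (?row a i)"
    using ai by (simp add: matrix_row_def Kvs.scale_sum_right)
  have rowi': "?row a i = pscale (inverse c\<^sub>i) (?row a' i)"
    using ci by (simp add: rowi)
  have rowk: "?row a' k = ?row a k - pscale (c k) (?row a' i)" if "k < s" "k \<noteq> i" for k
    using ak that by (simp add: matrix_row_def Kvs.scale_sum_right single_diff sum_subtractf)
  have mem: "?row a' k \<in> Kspan (?row a' ` {..<s})" "?row a k \<in> Kspan (?row a ` {..<s})"
    if "k < s" for k
    using that by (auto intro: Kvs.span_base)
  have i1: "?row a' i \<in> Kspan (?row a ` {..<s})"
    unfolding rowi by (rule Kvs.span_scale[OF mem(2)[OF i]])
  have "?row a' k \<in> Kspan (?row a ` {..<s})" if "k < s" for k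
    using i1 mem(2)[OF that] rowk[OF that]
    by (cases "k = i") (auto intro: Kvs.span_diff Kvs.span_scale)
  moreover have "?row a k \<in> Kspan (?row a' ` {..<s})" if "k < s" for k
  proof (cases "k = i")
    case True
    then show ?thesis unfolding rowi' True by (intro Kvs.span_scale mem(1)[OF i])
  next
    case False
    then have "?row a k = ?row a' k + pscale (c k) (?row a' i)" using rowk[OF that] by simp
    then show ?thesis using mem(1)[OF that] mem(1)[OF i]
      by (auto intro: Kvs.span_add Kvs.span_scale)
  qed
  ultimately show ?thesis
    by (intro antisym Kvs.span_minimal) auto
qed

text \<open>
  Stated for the final matrix and not for the output, because it is needed twice: for the correctness of
  a given output, and to see that the final rows can be marked consistently, so that an output exists.
\<close>

lemma interreduction_loop:
  fixes fs :: "('n::finite, 'k::field) mpoly list" and mt :: "('n, 'k) mpoly \<Rightarrow> 'n pterm"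
  defines "s \<equiv> length fs" and "a\<^sub>0 \<equiv> \<lambda>ts i j. coeff (fs ! i) (ts ! j)"
    and "p\<^sub>0 \<equiv> \<lambda>ts i. THE j. j < length ts \<and> ts ! j = mt (fs ! i)"
  assumes dist: "distinct fs" and mark: "is_marking (set fs) mt"
    and ts: "distinct ts" "set ts = (\<Union>f\<in>set fs. supp f)"
      "sorted_wrt (\<lambda>t u. tdeg t \<ge> tdeg u) ts"
    and loop: "fold (interreduction_step s (length ts)) [0..<s] (a\<^sub>0 ts, p\<^sub>0 ts) = (a, p)"
  shows "interreduction_inv s (length ts) (\<lambda>j. tdeg (ts ! j)) s a p"
    and "Kspan (matrix_row ts a ` {..<s}) = Kspan (set fs)"
    and "\<And>k r. marked_reduced (set (take k fs)) mt \<Longrightarrow> k \<le> s \<Longrightarrow> r < k \<Longrightarrow>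
      ts ! p r = mt (fs ! r) \<and> a r (p r) \<noteq> 0"
proof -
  define l where "l = length ts"
  define d where "d = (\<lambda>j. tdeg (ts ! j))"
  have p0: "p\<^sub>0 ts i < l" "ts ! p\<^sub>0 ts i = mt (fs ! i)" if "i < s" for i
  proof -
    have "mt (fs ! i) \<in> set ts"
      using that mark nth_mem[of i fs] unfolding ts(2) s_def is_marking_def by blast
    then obtain j where j: "j < l" "ts ! j = mt (fs ! i)" by (auto simp: in_set_conv_nth l_def)
    moreover have "p\<^sub>0 ts i = j"
      unfolding p\<^sub>0_def
    proof (rule the_equality)
      fix j' assume "j' < length ts \<and> ts ! j' = mt (fs ! i)"
      then show "j' = j" using j nth_eq_iff_index_eq[OF ts(1), of j' j] by (simp add: l_def)
    qed (use j in \<open>simp add: l_def\<close>)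
    ultimately show "p\<^sub>0 ts i < l" "ts ! p\<^sub>0 ts i = mt (fs ! i)" by simp_all
  qed
  have d: "d j' \<le> d j" if "j \<le> j'" "j' < l" for j j'
    using that ts(3) by (cases "j = j'") (auto simp: d_def l_def sorted_wrt_iff_nth_less)
  have inv0: "interreduction_inv s l d 0 (a\<^sub>0 ts) (p\<^sub>0 ts)"
  proof -
    have "d j \<le> d (p\<^sub>0 ts r)" if "r < s" "j < l" "a\<^sub>0 ts r j \<noteq> 0" for r j
      using that p0[OF that(1)] tdeg_le_marked[OF mark nth_mem[of r fs], of "ts ! j"]
      by (simp add: d_def a\<^sub>0_def s_def in_keys_iff)
    moreover have "a\<^sub>0 ts r (p\<^sub>0 ts r) \<noteq> 0" if "r < s" for r
      using p0[OF that] mark nth_mem[of r fs] that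
      by (simp add: a\<^sub>0_def is_marking_def s_def in_keys_iff)
    ultimately show ?thesis using p0 by (auto simp: interreduction_inv_def)
  qed
  define keep where "keep = (\<lambda>k a p. \<forall>r<k. p r = p\<^sub>0 ts r \<and> a r (p\<^sub>0 ts r) \<noteq> 0 \<and>
    (\<forall>r'<k. r' \<noteq> r \<longrightarrow> a r' (p\<^sub>0 ts r) = (0::'k)))"
  have keep0: "keep k (a\<^sub>0 ts) (p\<^sub>0 ts)" if red: "marked_reduced (set (take k fs)) mt" and k: "k \<le> s" for k
    unfolding keep_def
  proof (intro impI allI conjI)
    fix r assume r: "r < k"
    have mem: "fs ! r \<in> set (take k fs)" if "r < k" for r
      using that k by (auto simp: s_def in_set_conv_nth intro!: exI[of _ r])
    have rs: "r < s" using r k by simp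
    show "a\<^sub>0 ts r (p\<^sub>0 ts r) \<noteq> 0"
      using p0(2)[OF rs] coeff_marked[OF red mem[OF r] mem[OF r]] by (simp add: a\<^sub>0_def)
    fix r' assume r': "r' < k" "r' \<noteq> r"
    have "fs ! r' \<noteq> fs ! r" using r r' dist k by (simp add: nth_eq_iff_index_eq s_def)
    then show "a\<^sub>0 ts r' (p\<^sub>0 ts r) = 0"
      using p0(2)[OF rs] coeff_marked[OF red mem[OF r'(1)] mem[OF r]] by (simp add: a\<^sub>0_def)
  qed simp
  have *: "interreduction_inv s l d i a p \<and>
      Kspan (matrix_row ts a ` {..<s}) = Kspan (matrix_row ts (a\<^sub>0 ts) ` {..<s}) \<and>
      (\<forall>k\<le>s. marked_reduced (set (take k fs)) mt \<longrightarrow> keep k a p)"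
    if "i \<le> s" "fold (interreduction_step s l) [0..<i] (a\<^sub>0 ts, p\<^sub>0 ts) = (a, p)" for i a p
    using that
  proof (induction i arbitrary: a p)
    case 0
    then show ?case using inv0 keep0 by simp
  next
    case (Suc i)
    obtain a1 p1 where 1: "fold (interreduction_step s l) [0..<i] (a\<^sub>0 ts, p\<^sub>0 ts) = (a1, p1)"
      by fastforce
    then have step: "interreduction_step s l i (a1, p1) = (a, p)" using Suc.prems by simp
    have i: "i < s" using Suc.prems by simp
    have IH: "interreduction_inv s l d i a1 p1"
      "Kspan (matrix_row ts a1 ` {..<s}) = Kspan (matrix_row ts (a\<^sub>0 ts) ` {..<s})"
      "\<And>k. k \<le> s \<Longrightarrow> marked_reduced (set (take k fs)) mt \<Longrightarrow> keep k a1 p1"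
      using Suc.IH[OF less_imp_le[OF i] 1] by auto
    have "interreduction_inv s l d (Suc i) a p"
      by (rule interreduction_inv_step[OF IH(1) i d step])
    moreover have "Kspan (matrix_row ts a ` {..<s}) = Kspan (matrix_row ts a1 ` {..<s})"
      using interreduction_step_span[of s ts d i a1 p1 a p] IH(1) i step by (simp add: l_def)
    moreover have "keep k a p" if "k \<le> s" "marked_reduced (set (take k fs)) mt" for k
      using IH(3)[OF that] unfolding keep_def
      by (rule interreduction_step_keeps_pivots[OF IH(1) i that(1) _ step])
    ultimately show ?case using IH(2) by simp
  qed
  note final = *[OF order_refl loop[folded l_def]]
  show "interreduction_inv s (length ts) (\<lambda>j. tdeg (ts ! j)) s a p"
    using final unfolding l_def d_def by blast
  have "matrix_row ts (a\<^sub>0 ts) i = fs ! i" if "i < s" for i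
    unfolding a\<^sub>0_def by (rule matrix_row_coeffs[OF ts(1)]) (use that ts(2) in \<open>auto simp: s_def\<close>)
  then have "matrix_row ts (a\<^sub>0 ts) ` {..<s} = set fs"
    by (force simp: s_def in_set_conv_nth image_iff)
  then show "Kspan (matrix_row ts a ` {..<s}) = Kspan (set fs)" using final by simp
  show "ts ! p r = mt (fs ! r) \<and> a r (p r) \<noteq> 0"
    if "marked_reduced (set (take k fs)) mt" "k \<le> s" "r < k" for k r
    using final that p0(2)[of r] unfolding keep_def by auto
qed

lemma interreduction_inv_final:
  fixes a :: "nat \<Rightarrow> nat \<Rightarrow> 'k::field" and ts :: "'n::finite pterm list"
  assumes inv: "interreduction_inv s (length ts) (\<lambda>j. tdeg (ts ! j)) s a p" and ts: "distinct ts"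
    and r: "r < s" "matrix_row ts a r \<noteq> 0"
  shows "coeff (matrix_row ts a r) (ts ! p r) = 1"
    and "\<And>r'. r' < s \<Longrightarrow> r' \<noteq> r \<Longrightarrow> coeff (matrix_row ts a r') (ts ! p r) = 0"
    and "\<And>t. t \<in> supp (matrix_row ts a r) \<Longrightarrow> tdeg t \<le> tdeg (ts ! p r)"
proof -
  have pl: "p r < length ts" using inv r by (simp add: interreduction_inv_def)
  have nz: "\<exists>j<length ts. a r j \<noteq> 0" using r(2) matrix_row_eq_0_iff[OF ts] by auto
  show "coeff (matrix_row ts a r) (ts ! p r) = 1"
    using inv r nz by (simp add: interreduction_inv_def coeff_matrix_row[OF ts pl])
  show "coeff (matrix_row ts a r') (ts ! p r) = 0" if "r' < s" "r' \<noteq> r" for r'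
    using inv r nz that by (simp add: interreduction_inv_def coeff_matrix_row[OF ts pl])
  show "tdeg t \<le> tdeg (ts ! p r)" if t: "t \<in> supp (matrix_row ts a r)" for t
  proof -
    obtain j where j: "j < length ts" "t = ts ! j"
      using supp_matrix_row[of ts a r] t by (metis in_set_conv_nth subsetD)
    then have "a r j \<noteq> 0" using t coeff_matrix_row[OF ts j(1), of a r] by (simp add: in_keys_iff)
    then show ?thesis using inv r(1) nz j by (auto simp: interreduction_inv_def)
  qed
qed

text \<open>
  The last claim is the reason for listing \<open>V\<close> before the new products in step (T3 b): a basis that
  was reduced before keeps its marked terms, so that every new marked term enlarges it.
\<close>

theorem marked_interreduction_correct:
  fixes fs :: "('n::finite, 'k::field) mpoly list"
  assumes mi: "marked_interreduction fs mt G mt'"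
  shows "marked_reduced G mt'" and "Kspan G = Kspan (set fs)"
    and "\<And>k. marked_reduced (set (take k fs)) mt \<Longrightarrow> k \<le> length fs \<Longrightarrow>
      mt ` set (take k fs) \<subseteq> mt' ` G"
proof -
  define s where "s = length fs"
  from mi obtain ts where fs: "distinct fs" "is_marking (set fs) mt"
    and ts: "distinct ts" "set ts = (\<Union>f\<in>set fs. supp f)"
      "sorted_wrt (\<lambda>t u. tdeg t \<ge> tdeg u) ts"
    and fold: "(case fold (interreduction_step s (length ts)) [0..<s]
         (\<lambda>i j. coeff (fs ! i) (ts ! j), \<lambda>i. THE j. j < length ts \<and> ts ! j = mt (fs ! i)) of
       (a, p) \<Rightarrow> G = {matrix_row ts a i |i. i < s \<and> matrix_row ts a i \<noteq> 0} \<and>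
          (\<forall>i<s. matrix_row ts a i \<noteq> 0 \<longrightarrow> mt' (matrix_row ts a i) = ts ! p i))"
    unfolding marked_interreduction_def Let_def matrix_row_def s_def by auto
  obtain a p where ap: "fold (interreduction_step s (length ts)) [0..<s]
      (\<lambda>i j. coeff (fs ! i) (ts ! j), \<lambda>i. THE j. j < length ts \<and> ts ! j = mt (fs ! i)) = (a, p)"
    by fastforce
  let ?row = "matrix_row ts a"
  from fold ap have G: "G = {?row i |i. i < s \<and> ?row i \<noteq> 0}"
    and mt': "\<And>i. i < s \<Longrightarrow> ?row i \<noteq> 0 \<Longrightarrow> mt' (?row i) = ts ! p i"
    by simp_all
  note loop = interreduction_loop[OF fs ts ap[unfolded s_def], folded s_def]
  note final = interreduction_inv_final[OF loop(1) ts(1)]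
  show "marked_reduced G mt'"
    unfolding marked_reduced_def
  proof (intro conjI ballI impI is_markingI)
    show "finite G" by (rule finite_subset[of _ "?row ` {..<s}"]) (auto simp: G)
    fix v assume "v \<in> G"
    then obtain r where r: "r < s" "?row r \<noteq> 0" and v: "v = ?row r" by (auto simp: G)
    show 1: "coeff v (mt' v) = 1" using final(1)[OF r] mt'[OF r] by (simp add: v)
    then show "mt' v \<in> supp v" by (simp add: in_keys_iff)
    show "tdeg t \<le> tdeg (mt' v)" if "t \<in> supp v" for t
      using final(3)[OF r, of t] that mt'[OF r] by (simp add: v)
    fix w assume "w \<in> G" "v \<noteq> w"
    then obtain r' where r': "r' < s" "r' \<noteq> r" and w: "w = ?row r'" by (auto simp: G v)
    then show "mt' v \<notin> supp w"
      using final(2)[OF r r'] mt'[OF r] by (simp add: v in_keys_iff)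
  qed
  have "?row r \<in> Kspan G" if "r < s" for r
    using that by (cases "?row r = 0") (auto simp: G Kvs.span_zero intro!: Kvs.span_base)
  then have "Kspan (?row ` {..<s}) \<subseteq> Kspan G" by (intro Kvs.span_minimal) auto
  moreover have "Kspan G \<subseteq> Kspan (?row ` {..<s})" by (rule Kvs.span_mono) (auto simp: G)
  ultimately show "Kspan G = Kspan (set fs)" using loop(2) by simp
  show "mt ` set (take k fs) \<subseteq> mt' ` G"
    if red: "marked_reduced (set (take k fs)) mt" and k: "k \<le> length fs" for k
  proof
    fix t assume "t \<in> mt ` set (take k fs)"
    then obtain r where r: "r < k" "r < s" "t = mt (fs ! r)"
      by (auto simp: in_set_conv_nth s_def)
    have piv: "ts ! p r = mt (fs ! r)" "a r (p r) \<noteq> 0"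
      using loop(3)[OF red _ r(1)] k by (auto simp: s_def)
    moreover have "p r < length ts" using loop(1) r(2) by (simp add: interreduction_inv_def)
    ultimately have "?row r \<noteq> 0" using matrix_row_eq_0_iff[OF ts(1)] by blast
    then show "t \<in> mt' ` G"
      using mt'[of r] r piv by (auto simp: G intro!: image_eqI[of _ _ "?row r"])
  qed
qed

lemma marked_interreduction_exists:
  fixes fs :: "('n::finite, 'k::field) mpoly list"
  assumes fs: "distinct fs" "0 \<notin> set fs" "is_marking (set fs) mt"
  obtains G mt' where "marked_interreduction fs mt G mt'"
proof -
  define s where "s = length fs"
  have "finite (\<Union>f\<in>set fs. supp f)" by simp
  then obtain us where us: "set us = (\<Union>f\<in>set fs. supp f)" "distinct us"
    using finite_distinct_list by metis
  define ts where "ts = rev (sort_key tdeg us)"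
  have ts: "distinct ts" "set ts = (\<Union>f\<in>set fs. supp f)"
    using us by (simp_all add: ts_def)
  have srt: "sorted_wrt (\<lambda>t u. tdeg t \<ge> tdeg u) ts"
    using sorted_sort_key[of tdeg us] by (simp add: ts_def sorted_wrt_rev sorted_wrt_map)
  obtain a p where ap: "fold (interreduction_step s (length ts)) [0..<s]
      (\<lambda>i j. coeff (fs ! i) (ts ! j), \<lambda>i. THE j. j < length ts \<and> ts ! j = mt (fs ! i)) = (a, p)"
    by fastforce
  let ?row = "matrix_row ts a"
  note loop = interreduction_loop[OF fs(1,3) ts srt ap[unfolded s_def], folded s_def]
  note final = interreduction_inv_final[OF loop(1) ts(1)]
  \<comment> \<open>different indices give different nonzero rows, so the pivots define a marking\<close>
  define mt' where "mt' f = ts ! p (SOME i. i < s \<and> ?row i = f)" for f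
  have "mt' (?row i) = ts ! p i" if i: "i < s" "?row i \<noteq> 0" for i
  proof -
    let ?k = "SOME k. k < s \<and> ?row k = ?row i"
    have k: "?k < s" "?row ?k = ?row i" using someI[of "\<lambda>k. k < s \<and> ?row k = ?row i" i] i by auto
    have "?k = i"
    proof (rule ccontr)
      assume "?k \<noteq> i"
      then show False using final(1)[OF i] final(2)[OF i k(1)] k(2) by simp
    qed
    then show ?thesis unfolding mt'_def by (rule arg_cong)
  qed
  then have "marked_interreduction fs mt {?row i |i. i < s \<and> ?row i \<noteq> 0} mt'"
    unfolding marked_interreduction_def Let_def
    using fs ts srt ap by (intro conjI exI[of _ ts]) (auto simp: matrix_row_def s_def)
  then show ?thesis by (rule that)
qed

section \<open>Border bases from stable spans\<close>

definition linear_extension ::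
    "('n pterm \<Rightarrow> ('n, 'k::field) mpoly) \<Rightarrow> ('n, 'k) mpoly \<Rightarrow> ('n, 'k) mpoly"
  where "linear_extension h f = (\<Sum>t\<in>supp f. pscale (coeff f t) (h t))"

lemma linear_extension_superset:
  assumes "finite S" and "supp f \<subseteq> S"
  shows "linear_extension h f = (\<Sum>t\<in>S. pscale (coeff f t) (h t))"
  unfolding linear_extension_def using assms
  by (intro sum.mono_neutral_left) (auto simp: in_keys_iff)

lemma subspace_linear_extension_kernel: "Kvs.subspace {f. linear_extension h f = 0}"
proof (rule Kvs.subspaceI)
  fix f g assume "f \<in> {f. linear_extension h f = 0}" "g \<in> {f. linear_extension h f = 0}"
  then have 0: "linear_extension h f = 0" "linear_extension h g = 0" by auto
  let ?S = "supp f \<union> supp g"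
  have "linear_extension h (f + g) = linear_extension h f + linear_extension h g"
    using linear_extension_superset[of ?S "f + g" h] linear_extension_superset[of ?S f h]
      linear_extension_superset[of ?S g h] Poly_Mapping.keys_add[of f g]
    by (simp add: lookup_add Kvs.scale_left_distrib sum.distrib)
  then show "f + g \<in> {f. linear_extension h f = 0}" using 0 by simp
next
  fix c f assume "f \<in> {f. linear_extension h f = 0}"
  then have 0: "linear_extension h f = 0" by auto
  have "supp (pscale c f) \<subseteq> supp f" by (auto simp: in_keys_iff)
  then have "linear_extension h (pscale c f) = pscale c (linear_extension h f)"
    using linear_extension_superset[of "supp f" "pscale c f" h]
    by (simp add: linear_extension_def Kvs.scale_sum_right)
  then show "pscale c f \<in> {f. linear_extension h f = 0}" using 0 by simp
qed (simp add: linear_extension_def)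

lemma marked_remainder_sum:
  "marked_remainder V mt (\<Sum>x\<in>A. f x) = (\<Sum>x\<in>A. marked_remainder V mt (f x))"
  by (induction A rule: infinite_finite_induct) (auto simp: marked_remainder_add)

lemma marked_remainder_eq_linear_extension:
  "marked_remainder V mt f = linear_extension (\<lambda>t. marked_remainder V mt (monomial 1 t)) f"
proof -
  have "f = (\<Sum>t\<in>supp f. pscale (coeff f t) (monomial 1 t))"
    unfolding pscale_monomial mult_1_right by (rule poly_eq_sum_monomials) auto
  then have "marked_remainder V mt f =
      marked_remainder V mt (\<Sum>t\<in>supp f. pscale (coeff f t) (monomial 1 t))"
    by (rule arg_cong)
  also have "\<dots> = linear_extension (\<lambda>t. marked_remainder V mt (monomial 1 t)) f"
    unfolding linear_extension_def marked_remainder_sum marked_remainder_pscale ..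
  finally show ?thesis .
qed

text \<open>
  The condition under which a round ends without new elements.  It replaces the commutation of formal
  multiplication matrices that characterises border bases among border prebases.
\<close>

definition stable_in :: "'n pterm set \<Rightarrow> ('n, 'k::field) mpoly set \<Rightarrow> bool"
  where "stable_in U V \<longleftrightarrow> (\<forall>f\<in>Kspan (pplus V). supp f \<subseteq> U \<longrightarrow> f \<in> Kspan V)"

text \<open>
  The normal form of a term, obtained from a term in \<open>U\<close> by multiplying by one indeterminate after the
  other and taking remainders.  The first argument, meant to be the degree of the term, makes the
  recursion primitive; the order of the multiplications turns out to be irrelevant.
\<close>

primrec term_normal_form ::
    "('n, 'k::field) mpoly set \<Rightarrow> (('n, 'k) mpoly \<Rightarrow> 'n pterm) \<Rightarrow> 'n pterm set \<Rightarrow>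
      nat \<Rightarrow> 'n pterm \<Rightarrow> ('n, 'k) mpoly"
  where
    "term_normal_form V mt U 0 t = marked_remainder V mt (monomial 1 t)"
  | "term_normal_form V mt U (Suc d) t =
      (if t \<in> U then marked_remainder V mt (monomial 1 t)
       else let i = (SOME i. \<exists>t'. t = tvar i + t')
            in marked_remainder V mt (pvar i * term_normal_form V mt U d (t - tvar i)))"

text \<open>
  The data that the algorithm carries along: a finite universe \<open>U\<close> of terms, and a reduced basis \<open>V\<close> of
  a space of polynomials that lies between the span of \<open>F\<close> and the ideal.
\<close>

locale bba_basis =
  fixes F :: "('n::finite, 'k::field) mpoly set" and U :: "'n pterm set"
    and V :: "('n, 'k) mpoly set" and mt :: "('n, 'k) mpoly \<Rightarrow> 'n pterm"
  assumes U: "finite U" "order_ideal U" "U \<noteq> {}"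
    and red: "marked_reduced V mt"
    and supp_V: "(\<Union>v\<in>V. supp v) \<subseteq> U"
    and F_V: "F \<subseteq> Kspan V" and V_I: "V \<subseteq> ideal_of F"

locale stable_bba_basis = bba_basis F U V mt
  for F :: "('n::finite, 'k::field) mpoly set" and U V mt +
  fixes \<O> :: "'n pterm set"
  assumes stable: "stable_in U V"
    and \<O>: "\<O> = U - mt ` V" "order_ideal \<O>" "border \<O> \<subseteq> U"
begin

abbreviation "rem \<equiv> marked_remainder V mt"

lemma \<O>_subset: "\<O> \<subseteq> U" and finite_\<O>: "finite \<O>"
  using U \<O> by auto

lemma border_subset_marked: "border \<O> \<subseteq> mt ` V"
proof (cases "\<O> = {}")
  case True
  then show ?thesis using \<O> by (auto simp: border_def)
next
  case False
  then show ?thesis using \<O> by (auto simp: border_def)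
qed

lemma tvar_add_mem_U:
  assumes "t \<in> \<O>"
  shows "tvar i + t \<in> U"
proof (cases "tvar i + t \<in> \<O>")
  case True
  then show ?thesis using \<O>_subset by auto
next
  case False
  then have "tvar i + t \<in> border \<O>" using assms by (auto simp: border_def)
  then show ?thesis using \<O>(3) by auto
qed

lemma supp_pvar_times_subset: "supp f \<subseteq> \<O> \<Longrightarrow> supp (pvar i * f) \<subseteq> U"
  by (auto simp: supp_pvar_times intro: tvar_add_mem_U)

lemma supp_rem: "supp f \<subseteq> U \<Longrightarrow> supp (rem f) \<subseteq> \<O>"
  using supp_marked_remainder[OF red supp_V] \<O> by simp

lemma supp_rem_pvar_times: "supp f \<subseteq> \<O> \<Longrightarrow> supp (rem (pvar i * f)) \<subseteq> \<O>"
  by (intro supp_rem supp_pvar_times_subset)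

lemma rem_eq_self: "supp f \<subseteq> \<O> \<Longrightarrow> rem f = f"
  using \<O> by (intro marked_remainder_cong_unmarked) auto

lemma rem_eqI:
  assumes "f - g \<in> Kspan (pplus V)" and "supp f \<subseteq> U" and "supp g \<subseteq> U"
  shows "rem f = rem g"
proof -
  have "supp (f - g) \<subseteq> U" using Poly_Mapping.keys_diff[of f g] assms by auto
  then have "f - g \<in> Kspan V" using assms stable by (simp add: stable_in_def)
  then have "rem (f - g) = 0" using red by (simp add: marked_remainder_eq_0_iff)
  then show ?thesis by (simp add: marked_remainder_diff)
qed

lemma diff_rem_mem: "f - rem f \<in> Kspan (pplus V)"
  using diff_marked_remainder_mem_span Kvs.span_mono[OF pplus_superset] by blast

lemma pvar_times_diff_rem_mem: "pvar i * f - pvar i * rem f \<in> Kspan (pplus V)"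
  using pvar_times_mem_span_pplus[OF diff_marked_remainder_mem_span]
  by (simp add: right_diff_distrib)

text \<open>
  The multiplications by the indeterminates on the span of \<open>\<O>\<close> commute: computed in either order,
  the result differs from the true product by elements of the span of \<open>pplus V\<close>, and by stability
  differences in that span which are supported in \<open>U\<close> have remainder zero.
\<close>

lemma rem_pvar_times_commute:
  assumes f: "supp f \<subseteq> \<O>"
  shows "rem (pvar i * rem (pvar j * f)) = rem (pvar j * rem (pvar i * f))"
proof -
  have *: "pvar i * (pvar j * f) - rem (pvar i * rem (pvar j * f)) \<in> Kspan (pplus V)" for i j
    using Kvs.span_add[OF pvar_times_diff_rem_mem[of i "pvar j * f"]
        diff_rem_mem[of "pvar i * rem (pvar j * f)"]] by simp
  have "rem (rem (pvar i * rem (pvar j * f))) = rem (rem (pvar j * rem (pvar i * f)))"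
  proof (rule rem_eqI)
    show "rem (pvar i * rem (pvar j * f)) - rem (pvar j * rem (pvar i * f)) \<in> Kspan (pplus V)"
      using Kvs.span_diff[OF *[of j i] *[of i j]] by (simp add: mult.left_commute)
  qed (use f supp_rem_pvar_times \<O>_subset in blast)+
  then show ?thesis using f supp_rem_pvar_times rem_eq_self by simp
qed

definition normal_form :: "'n pterm \<Rightarrow> ('n, 'k) mpoly"
  where "normal_form t = term_normal_form V mt U (tdeg t) t"

lemma normal_form_U: "t \<in> U \<Longrightarrow> normal_form t = rem (monomial 1 t)"
  by (cases "tdeg t") (auto simp: normal_form_def)

lemma normal_form_not_U:
  assumes "t \<notin> U"
  obtains i t' where "t = tvar i + t'" and "normal_form t = rem (pvar i * normal_form t')"
proof -
  define i where "i = (SOME i. \<exists>t'. t = tvar i + t')"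
  have "t \<noteq> 0" using order_ideal_zero_mem[OF U(2,3)] assms by auto
  then have "\<exists>i t'. t = tvar i + t'" by (metis pterm_neq_0E)
  then have "\<exists>t'. t = tvar i + t'" unfolding i_def by (rule someI_ex)
  then obtain t' where t': "t = tvar i + t'" by blast
  have "tdeg t = Suc (tdeg t')" "t - tvar i = t'" by (simp_all add: t')
  then have "normal_form t = rem (pvar i * normal_form t')"
    using assms unfolding normal_form_def by (simp add: Let_def del: One_nat_def flip: i_def)
  with t' show ?thesis by (rule that)
qed

lemma supp_normal_form: "supp (normal_form t) \<subseteq> \<O>"
proof (induction "tdeg t" arbitrary: t rule: less_induct)
  case less
  show ?case
  proof (cases "t \<in> U")
    case True
    then show ?thesis by (simp add: normal_form_U supp_rem)
  next
    case False
    then obtain i t' where "t = tvar i + t'" "normal_form t = rem (pvar i * normal_form t')"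
      by (rule normal_form_not_U)
    then show ?thesis using less[of t'] supp_rem_pvar_times by simp
  qed
qed

text \<open>Commuting multiplications make the chosen order of the multiplications irrelevant.\<close>

lemma normal_form_tvar_add: "normal_form (tvar i + t) = rem (pvar i * normal_form t)"
proof (induction "tdeg t" arbitrary: t i rule: less_induct)
  case less
  show ?case
  proof (cases "tvar i + t \<in> U")
    case True
    then have t: "t \<in> U" by (rule order_ideal_tvar[OF U(2)])
    have "rem (monomial 1 (tvar i + t)) = rem (pvar i * rem (monomial 1 t))"
    proof (rule rem_eqI)
      show "monomial 1 (tvar i + t) - pvar i * rem (monomial 1 t) \<in> Kspan (pplus V)"
        using pvar_times_diff_rem_mem[of i "monomial 1 t"] by (simp add: pvar_times_monomial)
      have "supp (rem (monomial 1 t)) \<subseteq> \<O>" using t by (intro supp_rem) simp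
      then show "supp (pvar i * rem (monomial 1 t)) \<subseteq> U" by (rule supp_pvar_times_subset)
    qed (use True in simp)
    then show ?thesis using True t by (simp add: normal_form_U)
  next
    case False
    then obtain j t' where t': "tvar i + t = tvar j + t'"
      and nf: "normal_form (tvar i + t) = rem (pvar j * normal_form t')"
      by (rule normal_form_not_U)
    show ?thesis
    proof (cases "j = i")
      case True
      then show ?thesis using t' nf by simp
    next
      case False
      define u where "u = t - tvar j"
      have "Poly_Mapping.lookup (tvar i + t) j = Poly_Mapping.lookup (tvar j + t') j"
        using t' by simp
      then have "Poly_Mapping.lookup t j \<noteq> 0"
        using False by (simp add: lookup_add tvar_def lookup_single when_def)
      then have t: "t = tvar j + u"
        unfolding u_def by (intro poly_mapping_eqI)
          (auto simp: tvar_def lookup_add lookup_minus lookup_single when_def)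
      then have t'u: "t' = tvar i + u" using t' by (metis add.left_commute add_left_cancel)
      have u: "tdeg u < tdeg t" by (simp add: t)
      have "normal_form (tvar i + t) = rem (pvar j * rem (pvar i * normal_form u))"
        using nf less[OF u, of i] by (simp add: t'u)
      also have "\<dots> = rem (pvar i * rem (pvar j * normal_form u))"
        by (rule rem_pvar_times_commute[OF supp_normal_form])
      finally show ?thesis using less[OF u, of j] by (simp add: t)
    qed
  qed
qed

lemma linear_extension_normal_form_pvar_times:
  "linear_extension normal_form (pvar i * f) = rem (pvar i * linear_extension normal_form f)"
proof -
  have "linear_extension normal_form (pvar i * f) =
      (\<Sum>t\<in>supp f. pscale (coeff f t) (normal_form (tvar i + t)))"
    by (simp add: linear_extension_def supp_pvar_times sum.reindex)
  also have "\<dots> = rem (pvar i * linear_extension normal_form f)"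
    by (simp add: linear_extension_def normal_form_tvar_add marked_remainder_sum pvar_times_sum
        pvar_times_pscale marked_remainder_pscale)
  finally show ?thesis .
qed

lemma linear_extension_normal_form_U:
  assumes "supp f \<subseteq> U"
  shows "linear_extension normal_form f = rem f"
  unfolding marked_remainder_eq_linear_extension[of V mt f] linear_extension_def
  using assms by (intro sum.cong) (auto simp: normal_form_U)

text \<open>
  The kernel of the normal form map is an ideal that contains \<open>F\<close>, and the map is the identity on the
  span of \<open>\<O>\<close>.
\<close>

lemma ideal_Int_span_\<O>:
  assumes "f \<in> ideal_of F" and "supp f \<subseteq> \<O>"
  shows "f = 0"
proof -
  let ?K = "{f. linear_extension normal_form f = 0}"
  have "ideal_of F \<subseteq> ?K"
  proof (rule ideal_of_least[OF subspace_linear_extension_kernel])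
    show "F \<subseteq> ?K"
    proof
      fix g assume "g \<in> F"
      then have g: "g \<in> Kspan V" using F_V by auto
      then have "supp g \<subseteq> U" using supp_span supp_V by blast
      then show "g \<in> ?K"
        using g red by (simp add: linear_extension_normal_form_U marked_remainder_eq_0_iff)
    qed
  qed (simp add: linear_extension_normal_form_pvar_times)
  then have "linear_extension normal_form f = 0" using assms by auto
  then show "f = 0"
    using assms \<O>_subset rem_eq_self by (simp add: linear_extension_normal_form_U)
qed

text \<open>
  The products of \<open>\<O>\<close> with indeterminates lie in \<open>U\<close>, where remainders modulo \<open>V\<close> exist; so the sum of
  the ideal and the span of \<open>\<O>\<close> is closed under multiplication and contains 1.
\<close>

lemma decomposition_mod_ideal: "\<exists>g. supp g \<subseteq> \<O> \<and> f - g \<in> ideal_of F"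
proof -
  let ?S = "{f. \<exists>g. supp g \<subseteq> \<O> \<and> f - g \<in> ideal_of F}"
  have span_I: "h \<in> ideal_of F" if "h \<in> Kspan V" for h
    using Kspan_subset_ideal_of[OF V_I] that by auto
  have of_U: "f \<in> ?S" if "supp f \<subseteq> U" for f
    using supp_rem[OF that] span_I[OF diff_marked_remainder_mem_span] by blast
  have "ideal_of {1} \<subseteq> ?S"
  proof (rule ideal_of_least)
    show "Kvs.subspace ?S"
    proof (rule Kvs.subspaceI)
      fix f f' assume "f \<in> ?S" "f' \<in> ?S"
      then obtain g g' where "supp g \<subseteq> \<O>" "supp g' \<subseteq> \<O>" "f - g \<in> ideal_of F" "f' - g' \<in> ideal_of F"
        by blast
      then have "supp (g + g') \<subseteq> \<O>" "(f - g) + (f' - g') \<in> ideal_of F"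
        using Poly_Mapping.keys_add[of g g'] by (auto intro: Pmod.span_add)
      then show "f + f' \<in> ?S" by (auto simp: algebra_simps intro!: exI[of _ "g + g'"])
    next
      fix c f assume "f \<in> ?S"
      then obtain g where "supp g \<subseteq> \<O>" "f - g \<in> ideal_of F" by blast
      moreover from this have "pscale c (f - g) \<in> ideal_of F"
        by (intro Kvs.subspace_scale[OF subspace_ideal_of])
      moreover have "supp (pscale c g) \<subseteq> supp g" by (auto simp: in_keys_iff)
      ultimately show "pscale c f \<in> ?S"
        by (auto simp: Kvs.scale_right_diff_distrib intro!: exI[of _ "pscale c g"])
    qed (auto intro!: exI[of _ 0] Pmod.span_zero)
    show "{1} \<subseteq> ?S" using of_U[of 1] order_ideal_zero_mem[OF U(2,3)] by simp
    fix i f assume "f \<in> ?S"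
    then obtain g where g: "supp g \<subseteq> \<O>" "f - g \<in> ideal_of F" by blast
    have "pvar i * (f - g) \<in> ideal_of F" using g by (intro pvar_times_mem_ideal_of)
    moreover obtain h where "supp h \<subseteq> \<O>" "pvar i * g - h \<in> ideal_of F"
      using of_U[OF supp_pvar_times_subset[OF g(1)], of i] by blast
    ultimately have "pvar i * (f - g) + (pvar i * g - h) \<in> ideal_of F" "supp h \<subseteq> \<O>"
      by (auto intro: Pmod.span_add)
    then show "pvar i * f \<in> ?S" by (auto simp: right_diff_distrib)
  qed
  moreover have "f \<in> ideal_of {1}" using Pmod.span_scale[OF Pmod.span_base, of 1 "{1}" f] by simp
  ultimately show ?thesis by blast
qed

lemma is_residue_basis: "residue_basis \<O> (ideal_of F)"
  unfolding residue_basis_def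
proof (intro conjI allI impI ballI)
  fix c t assume I: "(\<Sum>t\<in>\<O>. monomial (c t) t) \<in> ideal_of F" and t: "t \<in> \<O>"
  have "supp (\<Sum>t\<in>\<O>. monomial (c t) t) \<subseteq> \<O>"
    by (auto simp: in_keys_iff coeff_sum_monomials[OF finite_\<O>] split: if_splits)
  with I have "(\<Sum>t\<in>\<O>. monomial (c t) t) = 0" by (rule ideal_Int_span_\<O>)
  then have "coeff (\<Sum>t\<in>\<O>. monomial (c t) t) t = 0" by simp
  then show "c t = 0" using t by (simp add: coeff_sum_monomials[OF finite_\<O>])
next
  fix f
  obtain g where g: "supp g \<subseteq> \<O>" "f - g \<in> ideal_of F" using decomposition_mod_ideal by blast
  then show "\<exists>c. f - (\<Sum>t\<in>\<O>. monomial (c t) t) \<in> ideal_of F"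
    using poly_eq_sum_monomials[OF finite_\<O> g(1)] by metis
qed

lemma supp_subset_marked:
  assumes "v \<in> V"
  shows "supp v \<subseteq> insert (mt v) \<O>"
proof
  fix t assume t: "t \<in> supp v"
  then have "t \<in> U" using supp_V assms by auto
  moreover have "t = mt v" if "w \<in> V" "t = mt w" for w
    using that t assms red by (auto simp: marked_reduced_def)
  ultimately show "t \<in> insert (mt v) \<O>" using \<O>(1) by auto
qed

lemma is_border_basis: "border_basis \<O> {g \<in> V. mt g \<in> border \<O>} (ideal_of F)"
proof -
  define g where "g = inv_into V mt"
  have g: "g b \<in> V" "mt (g b) = b" if "b \<in> border \<O>" for b
    using border_subset_marked that unfolding g_def by (auto intro: inv_into_into f_inv_into_f)
  have expand: "g b = monomial 1 b - (\<Sum>t\<in>\<O>. monomial (- coeff (g b) t) t)" if b: "b \<in> border \<O>" for b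
  proof -
    have nb: "b \<notin> \<O>" using border_subset_marked b \<O> by auto
    have "g b = (\<Sum>t\<in>insert b \<O>. monomial (coeff (g b) t) t)"
      using supp_subset_marked[OF g(1)[OF b]] g(2)[OF b] finite_\<O>
      by (intro poly_eq_sum_monomials) auto
    also have "\<dots> = monomial 1 b + (\<Sum>t\<in>\<O>. monomial (coeff (g b) t) t)"
      using nb finite_\<O> coeff_marked[OF red g(1)[OF b] g(1)[OF b]] g(2)[OF b] by simp
    also have "\<dots> = monomial 1 b - (\<Sum>t\<in>\<O>. monomial (- coeff (g b) t) t)"
      by (simp add: single_uminus sum_negf)
    finally show ?thesis .
  qed
  have "{g \<in> V. mt g \<in> border \<O>} = g ` border \<O>"
  proof
    show "g ` border \<O> \<subseteq> {g \<in> V. mt g \<in> border \<O>}" using g by auto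
    have "g (mt v) = v" if "v \<in> V" for v
      using that marked_reduced_inj_on[OF red] by (simp add: g_def)
    then show "{g \<in> V. mt g \<in> border \<O>} \<subseteq> g ` border \<O>"
      by (metis (no_types, lifting) image_eqI mem_Collect_eq subsetI)
  qed
  also have "g ` border \<O> =
      (\<lambda>b. monomial 1 b - (\<Sum>t\<in>\<O>. monomial (- coeff (g b) t) t)) ` border \<O>"
    by (rule image_cong[OF refl]) (rule expand)
  finally have "border_prebasis \<O> {g \<in> V. mt g \<in> border \<O>}"
    unfolding border_prebasis_def using finite_\<O> \<O>(2)
    by (intro conjI exI[of _ "\<lambda>t b. - coeff (g b) t"])
  then show ?thesis
    using V_I is_residue_basis by (auto simp: border_basis_def)
qed

lemma border_term_marked:
  assumes "v \<in> V" and "t \<in> supp v" and "t \<in> border \<O>"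
  shows "mt v = t"
  using assms supp_subset_marked[OF assms(1)] border_subset_marked \<O> by auto

end

section \<open>Bounding the number of extensions of the universe\<close>

text \<open>
  What stability gives for the span of \<open>V\<close> once the universe contains all terms up to degree \<open>M\<close>.  The
  universe itself does not occur here, so \<open>M\<close> can be determined from \<open>F\<close> alone.
\<close>

definition closed_upto :: "nat \<Rightarrow> ('n::finite, 'k::field) mpoly set \<Rightarrow> bool"
  where "closed_upto M L \<longleftrightarrow> Kvs.subspace L \<and>
    (\<forall>f\<in>L. \<forall>i. supp (pvar i * f) \<subseteq> terms_upto M \<longrightarrow> pvar i * f \<in> L)"

lemma closed_upto_mono:
  assumes "closed_upto M L" and "M' \<le> M"
  shows "closed_upto M' L"
proof -
  have "terms_upto M' \<subseteq> terms_upto M" using assms(2) by auto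
  then show ?thesis using assms(1) unfolding closed_upto_def by blast
qed

text \<open>
  Every element of the ideal is obtained from \<open>F\<close> by finitely many multiplications and linear
  combinations, all of them in bounded degree.
\<close>

lemma ideal_of_closed_upto:
  fixes F :: "('n::finite, 'k::field) mpoly set"
  assumes "f \<in> ideal_of F"
  obtains M where "\<And>L. closed_upto M L \<Longrightarrow> F \<subseteq> L \<Longrightarrow> f \<in> L"
proof -
  let ?P = "\<lambda>M f. \<forall>L. closed_upto M L \<and> F \<subseteq> L \<longrightarrow> f \<in> L"
  have mono: "?P M' f" if "?P M f" "M \<le> M'" for M M' and f :: "('n, 'k) mpoly"
    using that closed_upto_mono by blast
  have "ideal_of F \<subseteq> {f. \<exists>M. ?P M f}"
  proof (rule ideal_of_least)
    show "Kvs.subspace {f. \<exists>M. ?P M f}"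
    proof (rule Kvs.subspaceI)
      fix f g assume "f \<in> {f. \<exists>M. ?P M f}" "g \<in> {f. \<exists>M. ?P M f}"
      then obtain M N where "?P M f" "?P N g" by auto
      then have "?P (max M N) f" "?P (max M N) g"
        using mono[OF _ max.cobounded1] mono[OF _ max.cobounded2] by blast+
      then have "?P (max M N) (f + g)"
        by (metis closed_upto_def Kvs.subspace_add)
      then show "f + g \<in> {f. \<exists>M. ?P M f}" by blast
    next
      fix c f assume "f \<in> {f. \<exists>M. ?P M f}"
      then show "pscale c f \<in> {f. \<exists>M. ?P M f}"
        unfolding closed_upto_def using Kvs.subspace_scale by blast
    qed (auto simp: closed_upto_def Kvs.subspace_0)
    show "F \<subseteq> {f. \<exists>M. ?P M f}" by blast
    fix i f assume "f \<in> {f. \<exists>M. ?P M f}"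
    then obtain M where M: "?P M f" by auto
    obtain N where N: "supp (pvar i * f) \<subseteq> terms_upto N"
      using finite_subset_terms_upto[of "supp (pvar i * f)"] by auto
    have "?P (max M N) (pvar i * f)"
    proof (intro allI impI, elim conjE)
      fix L assume L: "closed_upto (max M N) L" "F \<subseteq> L"
      then have "f \<in> L" using mono[OF M max.cobounded1] by blast
      moreover have "supp (pvar i * f) \<subseteq> terms_upto (max M N)" using N by fastforce
      ultimately show "pvar i * f \<in> L" using L(1) by (simp add: closed_upto_def)
    qed
    then show "pvar i * f \<in> {f. \<exists>M. ?P M f}" by blast
  qed
  with assms obtain M where "?P M f" by blast
  then show ?thesis using that by blast
qed

text \<open>
  In a finite-dimensional quotient every term is congruent to a polynomial of degree less than \<open>D\<close>, the
  bound being given by representatives of generators of the quotient.  For the finitely many terms of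
  degree \<open>D\<close> these congruences can be derived in bounded degree.
\<close>

lemma zero_dimensional_reduction_degree:
  fixes F :: "('n::finite, 'k::field) mpoly set"
  assumes "zero_dimensional (ideal_of F)"
  obtains D M where "D \<le> M"
    and "\<And>L t. closed_upto M L \<Longrightarrow> F \<subseteq> L \<Longrightarrow> tdeg t = D \<Longrightarrow>
      \<exists>g. (\<forall>u\<in>supp g. tdeg u < D) \<and> monomial 1 t - g \<in> L"
proof -
  from assms obtain B where B: "finite B" "\<And>f. \<exists>g\<in>Kspan B. f - g \<in> ideal_of F"
    by (auto simp: zero_dimensional_def)
  have "finite (\<Union>b\<in>B. supp b)" using B by simp
  then obtain d where d: "(\<Union>b\<in>B. supp b) \<subseteq> terms_upto d"
    by (rule finite_subset_terms_upto)
  define D where "D = Suc d"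
  have "\<exists>g M. (\<forall>u\<in>supp g. tdeg u < D) \<and>
      (\<forall>L. closed_upto M L \<longrightarrow> F \<subseteq> L \<longrightarrow> monomial 1 t - g \<in> L)" for t :: "'n pterm"
  proof -
    obtain g where g: "g \<in> Kspan B" "monomial 1 t - g \<in> ideal_of F" using B(2) by blast
    obtain M where "\<And>L. closed_upto M L \<Longrightarrow> F \<subseteq> L \<Longrightarrow> monomial 1 t - g \<in> L"
      using ideal_of_closed_upto[OF g(2)] by blast
    moreover have "\<forall>u\<in>supp g. tdeg u < D" using supp_span[OF g(1)] d by (fastforce simp: D_def)
    ultimately show ?thesis by blast
  qed
  then obtain g M where gM: "\<And>t u. u \<in> supp (g t) \<Longrightarrow> tdeg u < D"
    "\<And>t L. closed_upto (M t) L \<Longrightarrow> F \<subseteq> L \<Longrightarrow> monomial 1 t - g t \<in> L" by metis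
  define N where "N = Max (insert D (M ` terms_upto D))"
  have le: "D \<le> N" "tdeg t \<le> D \<Longrightarrow> M t \<le> N" for t :: "'n pterm"
    unfolding N_def by (auto intro!: Max_ge)
  show ?thesis
  proof (rule that)
    show "D \<le> N" by (rule le)
    fix L and t :: "'n pterm" assume "closed_upto N L" "F \<subseteq> L" "tdeg t = D"
    then have "monomial 1 t - g t \<in> L" using gM(2) closed_upto_mono le(2)[of t] by blast
    then show "\<exists>g. (\<forall>u\<in>supp g. tdeg u < D) \<and> monomial 1 t - g \<in> L" using gM(1) by blast
  qed
qed

lemma zero_dimensional_nonempty:
  fixes F :: "('n::finite, 'k::field) mpoly set"
  assumes "zero_dimensional (ideal_of F)"
  shows "F \<noteq> {}"
proof
  assume F: "F = {}"
  obtain D M where "D \<le> M" and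
    DM: "\<And>L t. closed_upto M L \<Longrightarrow> F \<subseteq> L \<Longrightarrow> tdeg t = D \<Longrightarrow>
      \<exists>g. (\<forall>u\<in>supp g. tdeg u < D) \<and> monomial 1 t - g \<in> L"
    by (rule zero_dimensional_reduction_degree[OF assms]) blast
  let ?t = "Poly_Mapping.single (undefined :: 'n) D"
  have t: "tdeg ?t = D" by (simp add: tdeg_def lookup_single when_def)
  have "closed_upto M {0 :: ('n, 'k) mpoly}" by (simp add: closed_upto_def)
  then obtain g :: "('n, 'k) mpoly" where g: "\<forall>u\<in>supp g. tdeg u < D" "monomial 1 ?t - g \<in> {0}"
    using DM[OF _ _ t] F by blast
  then have "g = monomial 1 ?t" by simp
  then have "?t \<in> supp g" by simp
  then show False using g(1) t by (metis less_irrefl)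
qed

context bba_basis
begin

lemma closed_upto_Kspan:
  assumes "stable_in U V" and "terms_upto M \<subseteq> U"
  shows "closed_upto M (Kspan V)"
  unfolding closed_upto_def
proof (intro conjI ballI allI impI)
  fix f i assume "f \<in> Kspan V" and "supp (pvar i * f) \<subseteq> terms_upto M"
  then have "pvar i * f \<in> Kspan (pplus V)" and "supp (pvar i * f) \<subseteq> U"
    using assms(2) by (blast intro: pvar_times_mem_span_pplus)+
  then show "pvar i * f \<in> Kspan V" using assms(1) by (simp add: stable_in_def)
qed simp

text \<open>
  If the terms of degree \<open>D\<close> are congruent modulo the span of \<open>V\<close> to polynomials of degree less than
  \<open>D\<close>, then so are, by stability, all terms of \<open>U\<close> of degree at least \<open>D\<close>.  Such a term \<open>t\<close> must be
  marked: its congruence is a combination of elements of \<open>V\<close>, one of them contains \<open>t\<close>, and its marked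
  term, which occurs in the congruence and has at least the degree of \<open>t\<close>, can only be \<open>t\<close>.
\<close>

lemma unmarked_degree_bound:
  assumes stable: "stable_in U V" and D: "terms_upto D \<subseteq> U"
    and reduce: "\<And>t. tdeg t = D \<Longrightarrow>
      \<exists>g. (\<forall>u\<in>supp g. tdeg u < D) \<and> monomial 1 t - g \<in> Kspan V"
    and t: "t \<in> U - mt ` V"
  shows "tdeg t < D"
proof -
  let ?low = "{g. supp g \<subseteq> {u. tdeg u < D}} :: ('n, 'k) mpoly set"
  have low_upto: "\<exists>h\<in>?low. g - h \<in> Kspan V" if "supp g \<subseteq> terms_upto D" for g
  proof -
    have "\<exists>h\<in>?low. monomial c u - h \<in> Kspan V" if "tdeg u \<le> D" for c u
    proof (cases "tdeg u = D")
      case True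
      then obtain h where h: "\<forall>u\<in>supp h. tdeg u < D" "monomial 1 u - h \<in> Kspan V"
        using reduce by blast
      then have "pscale c (monomial 1 u - h) \<in> Kspan V" by (intro Kvs.span_scale)
      moreover have "pscale c h \<in> ?low" by (rule Kvs.subspace_scale[OF subspace_supp]) (use h in blast)
      ultimately show ?thesis
        by (intro bexI[of _ "pscale c h"]) (simp_all add: Kvs.scale_right_diff_distrib)
    next
      case False
      then show ?thesis using that
        by (intro bexI[of _ "monomial c u"]) (auto simp: Kvs.span_zero split: if_splits)
    qed
    then have "\<forall>u\<in>supp g. \<exists>h. h \<in> ?low \<and> monomial (coeff g u) u - h \<in> Kspan V"
      using that by blast
    then obtain h where h: "\<forall>u\<in>supp g. h u \<in> ?low \<and> monomial (coeff g u) u - h u \<in> Kspan V"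
      by (rule bchoice[THEN exE])
    let ?h = "\<Sum>u\<in>supp g. h u"
    have h': "?h \<in> ?low" by (rule Kvs.subspace_sum[OF subspace_supp]) (use h in blast)
    have "(\<Sum>u\<in>supp g. monomial (coeff g u) u - h u) \<in> Kspan V"
      by (rule Kvs.span_sum) (use h in blast)
    moreover have "(\<Sum>u\<in>supp g. monomial (coeff g u) u) = g"
      by (rule poly_eq_sum_monomials[symmetric]) auto
    ultimately have "g - ?h \<in> Kspan V" by (simp only: sum_subtractf)
    with h' show ?thesis by blast
  qed
  have low: "\<exists>g\<in>?low. monomial 1 u - g \<in> Kspan V" if "u \<in> U" "D \<le> tdeg u" for u
    using that
  proof (induction "tdeg u" arbitrary: u rule: less_induct)
    case less
    show ?case
    proof (cases "tdeg u = D")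
      case True
      then show ?thesis using reduce[of u] by auto
    next
      case False
      then have "u \<noteq> 0" using less.prems by auto
      then obtain i u' where u: "u = tvar i + u'" by (rule pterm_neq_0E)
      then have "u' \<in> U" using less.prems order_ideal_tvar[OF U(2)] by blast
      then obtain g where g: "g \<in> ?low" "monomial 1 u' - g \<in> Kspan V"
        using less(1)[of u'] less.prems False u by auto
      have xg: "supp (pvar i * g) \<subseteq> terms_upto D" using g(1) by (auto simp: supp_pvar_times)
      have "pvar i * (monomial 1 u' - g) \<in> Kspan (pplus V)"
        using g(2) by (rule pvar_times_mem_span_pplus)
      then have "monomial 1 u - pvar i * g \<in> Kspan (pplus V)"
        by (simp add: right_diff_distrib pvar_times_monomial u)
      moreover have "supp (monomial 1 u - pvar i * g) \<subseteq> U"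
        using Poly_Mapping.keys_diff[of "monomial 1 u" "pvar i * g"] xg D less.prems by auto
      ultimately have 1: "monomial 1 u - pvar i * g \<in> Kspan V"
        using stable by (simp add: stable_in_def)
      obtain h where h: "h \<in> ?low" "pvar i * g - h \<in> Kspan V" using low_upto[OF xg] by blast
      then have "monomial 1 u - h \<in> Kspan V" using Kvs.span_add[OF 1 h(2)] by simp
      then show ?thesis using h(1) by blast
    qed
  qed
  show ?thesis
  proof (rule ccontr)
    assume "\<not> tdeg t < D"
    then obtain g where g: "g \<in> ?low" "monomial 1 t - g \<in> Kspan V" using low[of t] t by auto
    let ?f = "monomial 1 t - g"
    have "1 = coeff ?f t" using g(1) \<open>\<not> tdeg t < D\<close> by (auto simp: lookup_minus in_keys_iff)
    also have "coeff ?f t = coeff (\<Sum>v\<in>V. pscale (coeff ?f (mt v)) v) t"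
      using marked_reduced_expansion[OF red g(2)] by (rule arg_cong)
    also have "\<dots> = (\<Sum>v\<in>V. coeff (pscale (coeff ?f (mt v)) v) t)" by (rule lookup_sum)
    finally obtain v where v: "v \<in> V" "coeff (pscale (coeff ?f (mt v)) v) t \<noteq> 0"
      by (metis (no_types, lifting) sum.neutral zero_neq_one)
    then have "coeff ?f (mt v) \<noteq> 0" "t \<in> supp v" by (auto simp: in_keys_iff)
    \<comment> \<open>the only term of degree at least \<open>D\<close> in this polynomial is \<open>t\<close>, which is not marked\<close>
    moreover have "tdeg t \<le> tdeg (mt v)"
      using tdeg_le_marked[of V mt v t] red v(1) \<open>t \<in> supp v\<close> by (simp add: marked_reduced_def)
    moreover have "mt v \<noteq> t" using t v(1) by auto
    ultimately have "mt v \<in> supp g" by (simp add: lookup_minus lookup_single in_keys_iff)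
    then show False
      using g(1) \<open>tdeg t \<le> tdeg (mt v)\<close> \<open>\<not> tdeg t < D\<close> by auto
  qed
qed

lemma border_subset_if_bounded:
  assumes "terms_upto D \<subseteq> U" and "\<And>t. t \<in> U - mt ` V \<Longrightarrow> tdeg t < D"
  shows "border (U - mt ` V) \<subseteq> U"
proof
  fix b assume b: "b \<in> border (U - mt ` V)"
  show "b \<in> U"
  proof (cases "U - mt ` V = {}")
    case True
    then show ?thesis using b order_ideal_zero_mem[OF U(2,3)] by (simp add: border_def)
  next
    case False
    then obtain i t where "b = tvar i + t" "t \<in> U - mt ` V" using b by (auto simp: border_def)
    then have "tdeg b \<le> D" using assms(2)[of t] by simp
    then show ?thesis using assms(1) by auto
  qed
qed

end

section \<open>One round of the algorithm\<close>

lemma (in bba_basis) pplus_subset_ideal_of: "Kspan (pplus V) \<subseteq> ideal_of F"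
  by (rule Kspan_subset_ideal_of) (use V_I in \<open>auto simp: pplus_def intro: pvar_times_mem_ideal_of\<close>)

text \<open>
  A round in which (T4) and (T5) have come to rest: \<open>X\<close> is the interreduced basis of the span of
  \<open>pplus V\<close>, and the elements of \<open>W\<close>, those with new marked terms in \<open>U\<close>, are supported in \<open>U\<close>.
\<close>

locale bba_round = bba_basis F U V mt
  for F :: "('n::finite, 'k::field) mpoly set" and U V mt +
  fixes X :: "('n, 'k) mpoly set" and mt' :: "('n, 'k) mpoly \<Rightarrow> 'n pterm" and V' W
  assumes red': "marked_reduced X mt'" and span: "Kspan X = Kspan (pplus V)"
    and keep: "mt ` V \<subseteq> mt' ` X"
    and V': "V' = {f \<in> X. mt' f \<in> mt ` V}" and W: "W = {f \<in> X - V'. mt' f \<in> U}"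
    and supp_W: "(\<Union>w\<in>W. supp w) \<subseteq> U"
begin

lemma V_mem_span: "v \<in> V \<Longrightarrow> v \<in> Kspan X"
  unfolding span using pplus_superset by (blast intro: Kvs.span_base)

text \<open>
  An element of \<open>V\<close> is reduced to the element of \<open>V'\<close> with the same marked term by elements whose marked
  terms occur in it, hence lie in \<open>U\<close>; among these the elements of \<open>V'\<close> are excluded because \<open>V\<close> is
  reduced.
\<close>

lemma V_V'_diff:
  assumes v: "v \<in> V" and v': "v' \<in> X" and eq: "mt' v' = mt v"
  shows "v - v' \<in> Kspan W"
proof (rule marked_reduced_mem_spanI[OF red'])
  show "v - v' \<in> Kspan X"
    using V_mem_span[OF v] Kvs.span_base[OF v'] by (rule Kvs.span_diff)
  fix x assume x: "x \<in> X" and supp: "mt' x \<in> supp (v - v')"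
  have xv': "x \<noteq> v'"
  proof
    assume "x = v'"
    then have "coeff (v - v') (mt' x) = 0"
      using coeff_marked[OF red v v] coeff_marked[OF red' v' v'] eq by (simp add: lookup_minus)
    then show False using supp by (simp add: in_keys_iff)
  qed
  then have "coeff v' (mt' x) = 0" using coeff_marked[OF red' v' x] by simp
  then have xv: "mt' x \<in> supp v" using supp by (simp add: in_keys_iff lookup_minus)
  have "x \<notin> V'"
  proof
    assume "x \<in> V'"
    then obtain u where u: "u \<in> V" "mt' x = mt u" using V' by auto
    then have "u = v" using xv red v by (auto simp: marked_reduced_def)
    then have "mt' x = mt' v'" using u eq by simp
    then show False using xv' marked_reduced_inj_on[OF red'] x v' by (auto dest: inj_onD)
  qed
  moreover have "mt' x \<in> U" using xv v supp_V by auto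
  ultimately show "x \<in> Kspan W" using x W by (auto intro: Kvs.span_base)
qed

lemma supp_V': "(\<Union>v'\<in>V'. supp v') \<subseteq> U"
proof (rule UN_least)
  fix v' assume "v' \<in> V'"
  then obtain v where v: "v \<in> V" "v' \<in> X" "mt' v' = mt v" using V' by auto
  have "supp (v - v') \<subseteq> U" using supp_span[OF V_V'_diff[OF v]] supp_W by blast
  moreover have "supp v \<subseteq> U" using v supp_V by auto
  moreover have "v' = v - (v - v')" by simp
  ultimately show "supp v' \<subseteq> U" using Poly_Mapping.keys_diff[of v "v - v'"] by auto
qed

lemma bba_basis_next: "bba_basis F U (V' \<union> W) mt'"
proof
  have sub: "V' \<union> W \<subseteq> X" using V' W by auto
  then show "marked_reduced (V' \<union> W) mt'" using red' by (rule marked_reduced_subset[rotated])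
  show "(\<Union>v\<in>V' \<union> W. supp v) \<subseteq> U" using supp_V' supp_W by auto
  have "v \<in> Kspan (V' \<union> W)" if v: "v \<in> V" for v
  proof (rule marked_reduced_mem_spanI[OF red' V_mem_span[OF v]])
    fix x assume "x \<in> X" "mt' x \<in> supp v"
    then have "x \<in> V' \<union> W" using v supp_V V' W by auto
    then show "x \<in> Kspan (V' \<union> W)" by (rule Kvs.span_base)
  qed
  then have "Kspan V \<subseteq> Kspan (V' \<union> W)" by (intro Kvs.span_minimal) auto
  then show "F \<subseteq> Kspan (V' \<union> W)" using F_V by auto
  show "V' \<union> W \<subseteq> ideal_of F"
    using sub pplus_subset_ideal_of span Kvs.span_superset[of X] by auto
qed (rule U)+

lemma card_less_next:
  assumes "W \<noteq> {}"
  shows "card V < card (V' \<union> W)"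
proof -
  have fin: "finite X" by (rule marked_reduced_finite[OF red'])
  then have finite: "finite V'" "finite W" using V' W by auto
  have "mt ` V \<subseteq> mt' ` V'"
  proof
    fix t assume t: "t \<in> mt ` V"
    then obtain x where "x \<in> X" "t = mt' x" using keep by auto
    then show "t \<in> mt' ` V'" using t V' by auto
  qed
  then have "card (mt ` V) \<le> card (mt' ` V')" using finite by (intro card_mono) auto
  also have "\<dots> \<le> card V'" using finite by (intro card_image_le)
  finally have "card V \<le> card V'" using card_image[OF marked_reduced_inj_on[OF red]] by simp
  moreover have "V' \<inter> W = {}" using W by auto
  moreover have "card W > 0" using finite assms by (simp add: card_gt_0_iff)
  ultimately show ?thesis using finite by (simp add: card_Un_disjoint)
qed

lemma stable_if_no_new:
  assumes "W = {}"
  shows "stable_in U V"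
  unfolding stable_in_def
proof (intro ballI impI)
  fix f assume f: "f \<in> Kspan (pplus V)" "supp f \<subseteq> U"
  show "f \<in> Kspan V"
  proof (rule marked_reduced_mem_spanI[OF red'])
    show "f \<in> Kspan X" using f span by simp
    fix x assume "x \<in> X" "mt' x \<in> supp f"
    then have "x \<in> V'" using f(2) W assms by auto
    then obtain v where v: "v \<in> V" "x \<in> X" "mt' x = mt v" using V' by auto
    have "v - x \<in> Kspan {}" using V_V'_diff[OF v] assms by simp
    then have "x = v" by simp
    then show "x \<in> Kspan V" using v by (auto intro: Kvs.span_base)
  qed
qed

end

lemma bba_basis_mono:
  assumes "bba_basis F U V mt" and "U \<subseteq> U'" and "finite U'" and "order_ideal U'"
  shows "bba_basis F U' V mt"
  using assms unfolding bba_basis_def by auto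

lemma bba_basis_cong:
  assumes "bba_basis F U V mt" and "\<And>v. v \<in> V \<Longrightarrow> mt' v = mt v"
  shows "bba_basis F U V mt'"
  using assms marked_reduced_cong unfolding bba_basis_def by blast

text \<open>
  Multiplication by an indeterminate shifts all degrees by one, so step (T3 a) marks terms of maximal
  degree and the interreduction always gets admissible input.
\<close>

lemma is_marking_pplus:
  assumes V: "is_marking V mt"
    and prod: "\<forall>f\<in>pplus V - V. \<exists>i. \<exists>v\<in>V. f = pvar i * v \<and> mt f = tvar i + mt v"
  shows "is_marking (pplus V) mt"
proof (rule is_markingI)
  fix f assume f: "f \<in> pplus V"
  consider "f \<in> V" | i v where "v \<in> V" "f = pvar i * v" "mt f = tvar i + mt v"
    using f prod by blast
  then show "mt f \<in> supp f"
    using V by cases (auto simp: supp_pvar_times is_marking_def)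
  fix t assume t: "t \<in> supp f"
  from \<open>f \<in> pplus V\<close> consider "f \<in> V" | i v where "v \<in> V" "f = pvar i * v" "mt f = tvar i + mt v"
    using prod by blast
  then show "tdeg t \<le> tdeg (mt f)"
  proof cases
    case 1
    then show ?thesis using tdeg_le_marked[OF V] t by blast
  next
    case 2
    then show ?thesis using tdeg_le_marked[OF V 2(1)] t by (auto simp: supp_pvar_times)
  qed
qed

section \<open>The invariant\<close>

text \<open>
  What the states within a round remember of the interreduction.  Only the two parts \<open>V'\<close> and \<open>W'\<close> of
  its result are recorded, so the choice of \<open>V'\<close> is expressed elementwise on their union.
\<close>

definition interreduced_pplus ::
    "('n::finite, 'k::field) mpoly set \<Rightarrow> (('n, 'k) mpoly \<Rightarrow> 'n pterm) \<Rightarrow>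
      ('n, 'k) mpoly set \<Rightarrow> ('n, 'k) mpoly set \<Rightarrow> (('n, 'k) mpoly \<Rightarrow> 'n pterm) \<Rightarrow> bool"
  where "interreduced_pplus V mt V' W' mt' \<longleftrightarrow>
    marked_reduced (V' \<union> W') mt' \<and> Kspan (V' \<union> W') = Kspan (pplus V) \<and>
    mt ` V \<subseteq> mt' ` (V' \<union> W') \<and> V' \<inter> W' = {} \<and>
    (\<forall>f\<in>V' \<union> W'. f \<in> V' \<longleftrightarrow> mt' f \<in> mt ` V)"

lemma bba_roundI:
  assumes "bba_basis F U V mt" and "interreduced_pplus V mt V' W' mt'"
    and "W = {w \<in> W'. mt' w \<in> U}" and "(\<Union>w\<in>W. supp w) \<subseteq> U"
  shows "bba_round F U V mt (V' \<union> W') mt' V' W"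
proof -
  have "V' \<union> W' - V' = W'" using assms(2) unfolding interreduced_pplus_def by blast
  then have W: "W = {w \<in> V' \<union> W' - V'. mt' w \<in> U}" using assms(3) by (simp only:)
  have V': "V' = {f \<in> V' \<union> W'. mt' f \<in> mt ` V}"
    using assms(2) unfolding interreduced_pplus_def by blast
  show ?thesis
    using assms(2) by (intro bba_round.intro bba_round_axioms.intro assms(1,4) V' W)
      (simp_all add: interreduced_pplus_def)
qed

text \<open>
  From \<open>At_T6\<close> on only the outcome of the round matters: a larger basis, or stability.
\<close>

fun bba_inv ::
    "('n::finite, 'k::field) mpoly set \<Rightarrow> ('n pterm, ('n, 'k) mpoly) bba_state \<Rightarrow> bool"
  where
    "bba_inv F At_T1 \<longleftrightarrow> True"
  | "bba_inv F (At_T2 U) \<longleftrightarrow> U = order_ideal_span (\<Union>f\<in>F. supp f)"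
  | "bba_inv F (At_T3 U V mt) \<longleftrightarrow> bba_basis F U V mt"
  | "bba_inv F (At_T3b U V mt) \<longleftrightarrow> bba_basis F U V mt \<and>
      (\<forall>f\<in>pplus V - V. \<exists>i. \<exists>v\<in>V. f = pvar i * v \<and> mt f = tvar i + mt v)"
  | "bba_inv F (At_T4 U V mt V' W' mt') \<longleftrightarrow> bba_basis F U V mt \<and> interreduced_pplus V mt V' W' mt'"
  | "bba_inv F (At_T5 U V mt V' W' W mt') \<longleftrightarrow> bba_basis F U V mt \<and>
      interreduced_pplus V mt V' W' mt' \<and> W = {w \<in> W'. mt' w \<in> U}"
  | "bba_inv F (At_T6 U V mt V' W mt') \<longleftrightarrow> bba_basis F U V mt \<and>
      (if W = {} then stable_in U V else bba_basis F U (V' \<union> W) mt' \<and> card V < card (V' \<union> W))"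
  | "bba_inv F (At_T7 U V mt) \<longleftrightarrow> bba_basis F U V mt \<and> stable_in U V"
  | "bba_inv F (At_T8 U V mt \<O>) \<longleftrightarrow> bba_basis F U V mt \<and> stable_in U V \<and>
      \<O> = U - mt ` V \<and> order_ideal \<O>"
  | "bba_inv F (At_T9 V mt \<O>) \<longleftrightarrow> (\<exists>U. stable_bba_basis F U V mt \<O>)"
  | "bba_inv F (Stopped_in_T7 \<O>) \<longleftrightarrow> \<not> order_ideal \<O>"
  | "bba_inv F (Output G mt \<O>) \<longleftrightarrow> finite \<O> \<and> order_ideal \<O> \<and> is_marking G mt \<and>
      border_basis \<O> G (ideal_of F) \<and> (\<forall>g\<in>G. \<forall>t\<in>supp g. t \<in> border \<O> \<longrightarrow> mt g = t)"

lemma finite_order_ideal_span_supp: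
  fixes F :: "('n::finite, 'k::zero) mpoly set"
  shows "finite F \<Longrightarrow> finite (order_ideal_span (\<Union>f\<in>F. supp f))"
  by (intro finite_order_ideal_span) auto

lemma bba_inv_step:
  fixes F :: "('n::finite, 'k::field) mpoly set"
  assumes F: "finite F" "F \<noteq> {}" and step: "bba_step F MT s s'" and inv: "bba_inv F s"
  shows "bba_inv F s'"
  using step inv
proof cases
  case (T2 fs V mt U)
  note red = marked_interreduction_correct(1,2)[OF T2(5)]
  have nz: "0 \<notin> F" using T2(4,5) by (auto simp: marked_interreduction_def)
  have U: "U = order_ideal_span (\<Union>f\<in>F. supp f)" using inv T2 by simp
  have sub: "(\<Union>f\<in>F. supp f) \<subseteq> U" unfolding U by (rule order_ideal_span_superset)
  have "bba_basis F U V mt"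
  proof
    show "finite U" unfolding U by (rule finite_order_ideal_span_supp[OF F(1)])
    show "order_ideal U" unfolding U by (rule order_ideal_order_ideal_span)
    obtain f where "f \<in> F" "f \<noteq> 0" using F nz by fastforce
    then obtain t where "t \<in> supp f" by fastforce
    then show "U \<noteq> {}" using sub \<open>f \<in> F\<close> by blast
    have "supp v \<subseteq> (\<Union>f\<in>F. supp f)" if "v \<in> V" for v
      using that red(2) T2(4) by (intro supp_span) (metis Kvs.span_base)
    then show "(\<Union>v\<in>V. supp v) \<subseteq> U" using sub by blast
    show "F \<subseteq> Kspan V" using red(2) T2(4) Kvs.span_superset by metis
    have "Kspan V \<subseteq> ideal_of F"
      unfolding red(2) T2(4) by (rule Kspan_subset_ideal_of) (rule Pmod.span_superset)
    then show "V \<subseteq> ideal_of F" using Kvs.span_superset by blast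
  qed (rule red(1))
  then show ?thesis by (simp add: T2)
next
  case (T3a V mt1 mt U)
  then have "bba_basis F U V mt" using inv by simp
  then have "bba_basis F U V mt1" by (rule bba_basis_cong) (use T3a in auto)
  moreover have "\<exists>i. \<exists>v\<in>V. f = pvar i * v \<and> mt1 f = tvar i + mt1 v" if "f \<in> pplus V - V" for f
    using T3a(3,4) that by (metis (no_types, lifting))
  ultimately show ?thesis by (simp add: T3a)
next
  case (T3bc vs V vs' mt Vt mt' V' W' U)
  have B: "bba_basis F U V mt" using inv T3bc by simp
  have Vt: "V' \<union> W' = Vt" "V' \<inter> W' = {}" using T3bc by auto
  have set: "set (vs @ vs') = pplus V" using T3bc(4,6) pplus_superset by auto
  have "mt ` set (take (length vs) (vs @ vs')) \<subseteq> mt' ` Vt"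
    using bba_basis.red[OF B] T3bc(4)
    by (intro marked_interreduction_correct(3)[OF T3bc(7)]) simp_all
  then have "mt ` V \<subseteq> mt' ` Vt" using T3bc(4) by simp
  moreover have "marked_reduced Vt mt'" "Kspan Vt = Kspan (pplus V)"
    using marked_interreduction_correct(1,2)[OF T3bc(7)] set by simp_all
  moreover have "f \<in> V' \<longleftrightarrow> mt' f \<in> mt ` V" if "f \<in> Vt" for f
    unfolding T3bc(8) using that by simp
  ultimately have "interreduced_pplus V mt V' W' mt'"
    unfolding interreduced_pplus_def Vt by blast
  with B show ?thesis by (simp add: T3bc)
next
  case (T5_extend W U U' V mt V' W' mt')
  have B: "bba_basis F U V mt" and I: "interreduced_pplus V mt V' W' mt'"
    and W: "W = {w \<in> W'. mt' w \<in> U}" using inv T5_extend by auto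
  have "finite W'" using I by (auto simp: interreduced_pplus_def dest: marked_reduced_finite)
  then have "finite W" using W by simp
  then have "finite U'"
    using bba_basis.U(1)[OF B] T5_extend(4) by (simp add: finite_order_ideal_span)
  moreover have "U \<subseteq> U'" using T5_extend(4) order_ideal_span_superset by blast
  moreover have "order_ideal U'" using T5_extend(4) order_ideal_order_ideal_span by simp
  ultimately show ?thesis using B I bba_basis_mono by (simp add: T5_extend) blast
next
  case (T5_next W U V mt V' W' mt')
  have B: "bba_basis F U V mt" using inv T5_next by auto
  interpret bba_round F U V mt "V' \<union> W'" mt' V' W
    using inv T5_next by (intro bba_roundI) auto
  show ?thesis
    using B bba_basis_next card_less_next stable_if_no_new by (simp add: T5_next)
next
  case (T8_extend \<O> U V mt)
  then have B: "bba_basis F U V mt" using inv by simp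
  then have "bba_basis F (tplus U) V mt"
    using tplus_superset finite_tplus order_ideal_tplus bba_basis.U[OF B] bba_basis_mono by metis
  then show ?thesis by (simp add: T8_extend)
next
  case (T8_next \<O> U V mt)
  have "stable_bba_basis F U V mt \<O>"
    using inv T8_next(3) unfolding T8_next(1) bba_inv.simps stable_bba_basis_def
      stable_bba_basis_axioms_def by blast
  then show ?thesis unfolding T8_next(2) bba_inv.simps by blast
next
  case (T9 G V mt \<O>)
  then obtain U where "stable_bba_basis F U V mt \<O>" using inv by auto
  then interpret stable_bba_basis F U V mt \<O> .
  have "is_marking G mt" using red T9 by (auto simp: marked_reduced_def is_marking_def)
  then show ?thesis
    using finite_\<O> \<O>(2) is_border_basis border_term_marked T9 by auto
qed (use inv in auto)

lemma bba_reachable_inv: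
  fixes F :: "('n::finite, 'k::field) mpoly set"
  assumes F: "finite F" "F \<noteq> {}" and "bba_reachable F MT s"
  shows "bba_inv F s"
  using assms(3) unfolding bba_reachable_def
  by (induction rule: rtranclp_induct) (simp, blast intro: bba_inv_step[OF F])

section \<open>Every step can be carried out\<close>

lemma bba_progress:
  fixes F :: "('n::finite, 'k::field) mpoly set"
  assumes F: "finite F" "0 \<notin> F" "is_marking F MT" and inv: "bba_inv F s"
    and stuck: "\<nexists>s'. bba_step F MT s s'"
  shows "(\<exists>\<O>. s = Stopped_in_T7 \<O>) \<or> (\<exists>G mt \<O>. s = Output G mt \<O>)"
proof (cases s)
  case At_T1
  then have "\<exists>s'. bba_step F MT s s'" by (auto intro: bba_step.T1)
  then show ?thesis using stuck by contradiction
next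
  case (At_T2 U)
  obtain fs where fs: "distinct fs" "set fs = F" using finite_distinct_list[OF F(1)] by blast
  have "0 \<notin> set fs" "is_marking (set fs) MT" using fs F by simp_all
  then obtain V mt where "marked_interreduction fs MT V mt"
    by (rule marked_interreduction_exists[OF fs(1)])
  then have "bba_step F MT (At_T2 U) (At_T3 U V mt)" by (rule bba_step.T2[OF fs])
  then show ?thesis using stuck At_T2 by blast
next
  case (At_T3 U V mt)
  have "\<forall>f\<in>pplus V - V. \<exists>t. \<exists>i. \<exists>v\<in>V. f = pvar i * v \<and> t = tvar i + mt v"
    by (auto simp: pplus_def)
  then obtain h where "\<forall>f\<in>pplus V - V. \<exists>i. \<exists>v\<in>V. f = pvar i * v \<and> h f = tvar i + mt v"
    by (rule bchoice[THEN exE])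
  then have "bba_step F MT (At_T3 U V mt) (At_T3b U V (\<lambda>f. if f \<in> V then mt f else h f))"
    by (intro bba_step.T3a) simp_all
  then show ?thesis using stuck At_T3 by blast
next
  case (At_T3b U V mt)
  then have B: "bba_basis F U V mt"
    and prod: "\<forall>f\<in>pplus V - V. \<exists>i. \<exists>v\<in>V. f = pvar i * v \<and> mt f = tvar i + mt v"
    using inv by simp_all
  have red: "marked_reduced V mt" using B by (rule bba_basis.red)
  then have fin: "finite V" "finite (pplus V - V)"
    by (simp_all add: marked_reduced_finite finite_pplus)
  obtain vs where vs: "distinct vs" "set vs = V"
    using finite_distinct_list[OF fin(1)] by blast
  obtain vs' where vs': "distinct vs'" "set vs' = pplus V - V"
    using finite_distinct_list[OF fin(2)] by blast
  have mark: "is_marking (pplus V) mt"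
    by (rule is_marking_pplus[OF _ prod]) (use red in \<open>simp add: marked_reduced_def\<close>)
  have set: "set (vs @ vs') = pplus V" using vs vs' pplus_superset by auto
  obtain Vt mt' where "marked_interreduction (vs @ vs') mt Vt mt'"
  proof (rule marked_interreduction_exists)
    show "distinct (vs @ vs')" using vs vs' by auto
    have "0 \<notin> pplus V" using mark by (auto simp: is_marking_def)
    then show "0 \<notin> set (vs @ vs')" unfolding set .
    show "is_marking (set (vs @ vs')) mt" unfolding set by (rule mark)
  qed
  then have "\<exists>s'. bba_step F MT (At_T3b U V mt) s'"
    by (intro exI) (rule bba_step.T3bc[OF vs vs' _ refl refl])
  then show ?thesis using stuck At_T3b by blast
next
  case (At_T4 U V mt V' W' mt')
  then have "\<exists>s'. bba_step F MT s s'" by (auto intro: bba_step.T4[OF refl])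
  then show ?thesis using stuck by contradiction
next
  case (At_T5 U V mt V' W' W mt')
  have "\<exists>s'. bba_step F MT s s'"
  proof (cases "(\<Union>w\<in>W. supp w) \<subseteq> U")
    case True
    show ?thesis unfolding At_T5 by (rule exI) (rule bba_step.T5_next[OF True])
  next
    case False
    show ?thesis unfolding At_T5 by (rule exI) (rule bba_step.T5_extend[OF False refl])
  qed
  then show ?thesis using stuck by contradiction
next
  case (At_T6 U V mt V' W mt')
  have "\<exists>s'. bba_step F MT s s'"
  proof (cases "W = {}")
    case True
    show ?thesis unfolding At_T6 by (rule exI) (rule bba_step.T6_next[OF True])
  next
    case False
    show ?thesis unfolding At_T6 by (rule exI) (rule bba_step.T6_repeat[OF False])
  qed
  then show ?thesis using stuck by contradiction
next
  case (At_T7 U V mt)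
  have "\<exists>s'. bba_step F MT s s'"
  proof (cases "order_ideal (U - mt ` V)")
    case True
    show ?thesis unfolding At_T7 by (rule exI) (rule bba_step.T7_next[OF refl True])
  next
    case False
    show ?thesis unfolding At_T7 by (rule exI) (rule bba_step.T7_stop[OF refl False])
  qed
  then show ?thesis using stuck by contradiction
next
  case (At_T8 U V mt \<O>)
  have "\<exists>s'. bba_step F MT s s'"
  proof (cases "border \<O> \<subseteq> U")
    case True
    show ?thesis unfolding At_T8 by (rule exI) (rule bba_step.T8_next[OF True])
  next
    case False
    show ?thesis unfolding At_T8 by (rule exI) (rule bba_step.T8_extend[OF False])
  qed
  then show ?thesis using stuck by contradiction
next
  case (At_T9 V mt \<O>)
  then have "\<exists>s'. bba_step F MT s s'" by (auto intro: bba_step.T9[OF refl])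
  then show ?thesis using stuck by contradiction
qed auto

section \<open>Termination\<close>

text \<open>
  Every marked term has maximal degree in its polynomial, so step (T5) never raises the maximal degree
  of the universe, and the number of terms up to that degree bounds the size of \<open>V\<close>.
\<close>

definition degree_hull :: "'n::finite pterm set \<Rightarrow> 'n pterm set"
  where "degree_hull U = {t. \<exists>u\<in>U. tdeg t \<le> tdeg u}"

lemma finite_degree_hull:
  assumes "finite U"
  shows "finite (degree_hull U)"
proof -
  obtain d where "U \<subseteq> terms_upto d" using assms by (rule finite_subset_terms_upto)
  then have "degree_hull U \<subseteq> terms_upto d" by (fastforce simp: degree_hull_def)
  then show ?thesis by (rule finite_subset) simp
qed

lemma (in bba_basis) card_le_degree_hull: "card V \<le> card (degree_hull U)"
proof -
  have "mt ` V \<subseteq> degree_hull U"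
    using supp_V marked_reduced_mem_supp[OF red] by (fastforce simp: degree_hull_def)
  then have "card (mt ` V) \<le> card (degree_hull U)"
    by (intro card_mono finite_degree_hull U)
  then show ?thesis using card_image[OF marked_reduced_inj_on[OF red]] by simp
qed

lemma degree_hull_extend:
  assumes red: "marked_reduced X mt" and W: "W \<subseteq> X" "mt ` W \<subseteq> U"
  shows "degree_hull (order_ideal_span (U \<union> (\<Union>w\<in>W. supp w))) \<subseteq> degree_hull U"
proof
  fix t assume "t \<in> degree_hull (order_ideal_span (U \<union> (\<Union>w\<in>W. supp w)))"
  then obtain u u' where u: "tdeg t \<le> tdeg u" "tdvd u u'" "u' \<in> U \<union> (\<Union>w\<in>W. supp w)"
    by (auto simp: degree_hull_def order_ideal_span_def)
  have mark: "is_marking X mt" using red by (simp add: marked_reduced_def)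
  have "\<exists>u''\<in>U. tdeg u' \<le> tdeg u''"
    using u(3) W tdeg_le_marked[OF mark] by blast
  then obtain u'' where "u'' \<in> U" "tdeg u' \<le> tdeg u''" by blast
  moreover from this have "tdeg t \<le> tdeg u''" using u(1) tdvd_tdeg[OF u(2)] by linarith
  ultimately show "t \<in> degree_hull U" by (auto simp: degree_hull_def)
qed

text \<open>A missing term of minimal degree is a product \<open>x\<^sub>i u\<close> with \<open>u\<close> in the order ideal.\<close>

lemma card_missing_tplus:
  assumes U: "order_ideal U" "U \<noteq> {}" and "\<not> terms_upto M \<subseteq> U"
  shows "card (terms_upto M - tplus U) < card (terms_upto M - U)"
proof (rule psubset_card_mono)
  obtain t where t: "t \<in> terms_upto M - U" "\<And>u. u \<in> terms_upto M - U \<Longrightarrow> tdeg t \<le> tdeg u"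
    using assms(3) ex_has_least_nat[of "\<lambda>t. t \<in> terms_upto M - U" _ tdeg] by blast
  then have "t \<noteq> 0" using order_ideal_zero_mem[OF U] by auto
  then obtain i u where u: "t = tvar i + u" by (rule pterm_neq_0E)
  then have "u \<in> U" using t(1) t(2)[of u] by auto
  then have "t \<in> tplus U" unfolding u by (rule tvar_add_mem_tplus)
  then show "terms_upto M - tplus U \<subset> terms_upto M - U" using t(1) tplus_superset by blast
qed simp

text \<open>
  The components count: the terms up to degree \<open>M\<close> that are missing in the universe, which (T8) makes
  fewer; the room for new elements of \<open>V\<close>, which (T6) makes smaller; the steps left in the round; and
  the elements of \<open>W'\<close> not supported in the universe, which (T5) makes fewer.  The last component is
  doubled so that it also distinguishes \<open>At_T4\<close> from \<open>At_T5\<close>.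
\<close>

fun bba_rank ::
    "nat \<Rightarrow> ('n::finite pterm, ('n, 'k::field) mpoly) bba_state \<Rightarrow> nat \<times> nat \<times> nat \<times> nat"
  where
    "bba_rank M At_T1 = (Suc (card (terms_upto M :: 'n pterm set)), 0, 0, 0)"
  | "bba_rank M (At_T2 U) = (card (terms_upto M - U), card (degree_hull U), 8, 0)"
  | "bba_rank M (At_T3 U V mt) = (card (terms_upto M - U), card (degree_hull U) - card V, 7, 0)"
  | "bba_rank M (At_T3b U V mt) = (card (terms_upto M - U), card (degree_hull U) - card V, 6, 0)"
  | "bba_rank M (At_T4 U V mt V' W' mt') = (card (terms_upto M - U),
      card (degree_hull U) - card V, 5, Suc (2 * card {w \<in> W'. \<not> supp w \<subseteq> U}))"
  | "bba_rank M (At_T5 U V mt V' W' W mt') = (card (terms_upto M - U),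
      card (degree_hull U) - card V, 5, 2 * card {w \<in> W'. \<not> supp w \<subseteq> U})"
  | "bba_rank M (At_T6 U V mt V' W mt') = (card (terms_upto M - U),
      card (degree_hull U) - card V, 4, 0)"
  | "bba_rank M (At_T7 U V mt) = (card (terms_upto M - U), card (degree_hull U) - card V, 3, 0)"
  | "bba_rank M (At_T8 U V mt \<O>) = (card (terms_upto M - U), card (degree_hull U) - card V, 2, 0)"
  | "bba_rank M (At_T9 V mt \<O>) = (0, 0, 1, 0)"
  | "bba_rank M (Stopped_in_T7 \<O>) = (0, 0, 0, 0)"
  | "bba_rank M (Output G mt \<O>) = (0, 0, 0, 0)"

abbreviation lex4 :: "((nat \<times> nat \<times> nat \<times> nat) \<times> nat \<times> nat \<times> nat \<times> nat) set"
  where "lex4 \<equiv> less_than <*lex*> less_than <*lex*> less_than <*lex*> less_than"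

lemma lex_leI: "x' \<le> (x::nat) \<Longrightarrow> (y', y) \<in> r \<Longrightarrow> ((x', y'), (x, y)) \<in> less_than <*lex*> r"
  by auto

text \<open>
  The number \<open>M\<close> of the rank has to be chosen in advance; \<open>D\<close> and \<open>M\<close> as provided by
  \<open>zero_dimensional_reduction_degree\<close> exclude an extension in (T8) with nothing missing.
\<close>

lemma bba_rank_decreases:
  fixes F :: "('n::finite, 'k::field) mpoly set"
  assumes F: "finite F" "F \<noteq> {}"
    and DM: "D \<le> M" "\<And>L t. closed_upto M L \<Longrightarrow> F \<subseteq> L \<Longrightarrow> tdeg t = D \<Longrightarrow>
      \<exists>g. (\<forall>u\<in>supp g. tdeg u < D) \<and> monomial 1 t - g \<in> L"
    and step: "bba_step F MT s s'" and inv: "bba_inv F s"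
  shows "(bba_rank M s', bba_rank M s) \<in> lex4"
  using step inv
proof cases
  case T1
  have "card (terms_upto M - U) < Suc (card (terms_upto M :: 'n pterm set))" for U :: "'n pterm set"
    by (rule le_imp_less_Suc, rule card_mono) auto
  then show ?thesis by (simp add: T1)
next
  case (T5_extend W U U' V mt V' W' mt')
  have B: "bba_basis F U V mt" and I: "interreduced_pplus V mt V' W' mt'"
    and W: "W = {w \<in> W'. mt' w \<in> U}" using inv T5_extend by auto
  have red: "marked_reduced (V' \<union> W') mt'" using I by (simp add: interreduced_pplus_def)
  have "U \<union> (\<Union>w\<in>W. supp w) \<subseteq> U'"
    unfolding T5_extend(4) by (rule order_ideal_span_superset)
  then have UU': "U \<subseteq> U'" "\<And>w. w \<in> W \<Longrightarrow> supp w \<subseteq> U'" by auto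
  have "card (terms_upto M - U') \<le> card (terms_upto M - U)"
    using UU' by (intro card_mono) auto
  moreover have "degree_hull U' \<subseteq> degree_hull U"
    unfolding T5_extend(4) using W by (intro degree_hull_extend[OF red]) auto
  then have "card (degree_hull U') \<le> card (degree_hull U)"
    by (intro card_mono finite_degree_hull bba_basis.U(1)[OF B])
  then have "card (degree_hull U') - card V \<le> card (degree_hull U) - card V" by simp
  moreover have "card {w \<in> W'. \<not> supp w \<subseteq> U'} < card {w \<in> W'. \<not> supp w \<subseteq> U}"
  proof (rule psubset_card_mono)
    show "finite {w \<in> W'. \<not> supp w \<subseteq> U}" using marked_reduced_finite[OF red] by simp
    obtain w where "w \<in> W" "\<not> supp w \<subseteq> U" using T5_extend(3) by blast
    moreover from this have "w \<in> W'" "supp w \<subseteq> U'" using W UU'(2) by simp_all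
    ultimately show "{w \<in> W'. \<not> supp w \<subseteq> U'} \<subset> {w \<in> W'. \<not> supp w \<subseteq> U}"
      using UU'(1) by blast
  qed
  then have "(Suc (2 * card {w \<in> W'. \<not> supp w \<subseteq> U'}), 2 * card {w \<in> W'. \<not> supp w \<subseteq> U}) \<in> less_than"
    by simp
  ultimately show ?thesis unfolding T5_extend(1,2) bba_rank.simps
    by (intro lex_leI order_refl)
next
  case (T6_repeat W U V mt V' mt')
  then have "bba_basis F U (V' \<union> W) mt'" "card V < card (V' \<union> W)" using inv by auto
  then have "card (degree_hull U) - card (V' \<union> W) < card (degree_hull U) - card V"
    using bba_basis.card_le_degree_hull by fastforce
  then show ?thesis by (simp add: T6_repeat(1,2))
next
  case (T8_extend \<O> U V mt)
  then have B: "bba_basis F U V mt" and stable: "stable_in U V" and \<O>: "\<O> = U - mt ` V"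
    using inv by auto
  \<comment> \<open>once the universe contains all terms up to degree \<open>M\<close>, the border of \<open>\<O>\<close> lies in it\<close>
  have "\<not> terms_upto M \<subseteq> U"
  proof
    assume M: "terms_upto M \<subseteq> U"
    have D: "terms_upto D \<subseteq> U" using M DM(1) by auto
    have "\<exists>g. (\<forall>u\<in>supp g. tdeg u < D) \<and> monomial 1 t - g \<in> Kspan V" if "tdeg t = D" for t
      using DM(2)[OF bba_basis.closed_upto_Kspan[OF B stable M] bba_basis.F_V[OF B] that] .
    then have "tdeg t < D" if "t \<in> \<O>" for t
      using bba_basis.unmarked_degree_bound[OF B stable D] that \<O> by blast
    then have "border \<O> \<subseteq> U"
      using bba_basis.border_subset_if_bounded[OF B D] \<O> by blast
    then show False using T8_extend by simp
  qed
  then show ?thesis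
    using card_missing_tplus[OF bba_basis.U(2,3)[OF B]] by (simp add: T8_extend(1,2))
next
  case T2
  show ?thesis unfolding T2(1,2) bba_rank.simps by (rule lex_leI[OF order_refl lex_leI]) simp_all
qed auto

lemma bba_terminates:
  fixes F :: "('n::finite, 'k::field) mpoly set"
  assumes F: "finite F" "zero_dimensional (ideal_of F)"
  shows "\<nexists>\<sigma>. \<sigma> 0 = At_T1 \<and> (\<forall>k. bba_step F MT (\<sigma> k) (\<sigma> (Suc k)))"
proof
  assume "\<exists>\<sigma>. \<sigma> 0 = At_T1 \<and> (\<forall>k. bba_step F MT (\<sigma> k) (\<sigma> (Suc k)))"
  then obtain \<sigma> where \<sigma>: "\<sigma> 0 = At_T1" "\<And>k. bba_step F MT (\<sigma> k) (\<sigma> (Suc k))" by blast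
  have ne: "F \<noteq> {}" using zero_dimensional_nonempty[OF F(2)] .
  have inv: "bba_inv F (\<sigma> k)" for k
    by (induction k) (auto simp: \<sigma>(1) intro: bba_inv_step[OF F(1) ne \<sigma>(2)])
  obtain D M where DM: "D \<le> M" "\<And>L t. closed_upto M L \<Longrightarrow> F \<subseteq> L \<Longrightarrow> tdeg t = D \<Longrightarrow>
      \<exists>g. (\<forall>u\<in>supp g. tdeg u < D) \<and> monomial 1 t - g \<in> L"
    by (rule zero_dimensional_reduction_degree[OF F(2)]) blast
  have "(bba_rank M (\<sigma> (Suc k)), bba_rank M (\<sigma> k)) \<in> lex4" for k
    by (rule bba_rank_decreases[OF F(1) ne DM \<sigma>(2) inv])
  then have "\<exists>f. \<forall>k. (f (Suc k), f k) \<in> lex4"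
    by (intro exI[of _ "\<lambda>k. bba_rank M (\<sigma> k)"] allI)
  moreover have "wf lex4" by (intro wf_lex_prod wf_less_than)
  ultimately show False unfolding wf_iff_no_infinite_down_chain by contradiction
qed

section \<open>Correctness of the algorithm\<close>

lemma marked_reduced_is_K_basis: "marked_reduced B mt \<Longrightarrow> Kspan B = S \<Longrightarrow> is_K_basis B S"
  by (simp add: is_K_basis_def marked_reduced_independent)

theorem proposition3p8:
  fixes F :: "('n::finite, 'k::field) mpoly set"
    and MT :: "('n, 'k) mpoly \<Rightarrow> 'n pterm"
  assumes "finite F" and "0 \<notin> F" and "is_marking F MT"
    and "\<forall>f\<in>F. \<forall>g\<in>F. f \<noteq> g \<longrightarrow> MT f \<notin> supp g"
    and "zero_dimensional (ideal_of F)"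
  shows
    \<comment> \<open>the procedure terminates, whatever choices are made\<close>
    "(\<nexists>\<sigma>. \<sigma> 0 = At_T1 \<and> (\<forall>k. bba_step F MT (\<sigma> k) (\<sigma> (Suc k))))
    \<comment> \<open>(T2) computes what it announces\<close>
    \<and> (\<forall>\<U> \<V> mt. bba_reachable F MT (At_T2 \<U>) \<and> bba_step F MT (At_T2 \<U>) (At_T3 \<U> \<V> mt) \<longrightarrow>
        is_marking \<V> mt \<and> is_K_basis \<V> (Kspan F) \<and> inj_on mt \<V>)
    \<comment> \<open>(T3) computes what it announces\<close>
    \<and> (\<forall>\<U> \<V> mt \<V>' \<W>' mt'. bba_reachable F MT (At_T3b \<U> \<V> mt) \<and>
          bba_step F MT (At_T3b \<U> \<V> mt) (At_T4 \<U> \<V> mt \<V>' \<W>' mt') \<longrightarrow>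
        is_marking (\<V>' \<union> \<W>') mt' \<and> is_K_basis (\<V>' \<union> \<W>') (Kspan (pplus \<V>)) \<and>
        inj_on mt' (\<V>' \<union> \<W>') \<and>
        (\<forall>v\<in>\<V>' \<union> \<W>'. \<forall>w\<in>\<V>' \<union> \<W>'. v \<noteq> w \<longrightarrow> mt' v \<notin> supp w))
    \<comment> \<open>every step can be carried out, and the procedure ends in one of the two ways\<close>
    \<and> (\<forall>s. bba_reachable F MT s \<and> (\<nexists>s'. bba_step F MT s s') \<longrightarrow>
        (\<exists>\<O>. s = Stopped_in_T7 \<O> \<and> \<not> order_ideal \<O>) \<or>
        (\<exists>G mt \<O>. s = Output G mt \<O> \<and>
          finite \<O> \<and> order_ideal \<O> \<and> is_marking G mt \<and>
          border_basis \<O> G (ideal_of F) \<and>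
          (\<forall>g\<in>G. \<forall>t\<in>supp g. t \<in> border \<O> \<longrightarrow> mt g = t)))"
proof (intro conjI allI impI)
  have ne: "F \<noteq> {}" by (rule zero_dimensional_nonempty[OF assms(5)])
  note inv = bba_reachable_inv[OF assms(1) ne]
  show "\<nexists>\<sigma>. \<sigma> 0 = At_T1 \<and> (\<forall>k. bba_step F MT (\<sigma> k) (\<sigma> (Suc k)))"
    by (rule bba_terminates[OF assms(1,5)])
  {
    fix \<U> \<V> mt
    assume "bba_reachable F MT (At_T2 \<U>) \<and> bba_step F MT (At_T2 \<U>) (At_T3 \<U> \<V> mt)"
    then obtain fs where "set fs = F" "marked_interreduction fs MT \<V> mt"
      by (auto elim: bba_step.cases)
    then have red: "marked_reduced \<V> mt" and span: "Kspan \<V> = Kspan F"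
      using marked_interreduction_correct(1,2) by metis+
    show "is_marking \<V> mt" using red by (simp add: marked_reduced_def)
    show "is_K_basis \<V> (Kspan F)" using red span by (rule marked_reduced_is_K_basis)
    show "inj_on mt \<V>" using red by (rule marked_reduced_inj_on)
  next
    fix \<U> \<V> mt \<V>' \<W>' mt'
    assume "bba_reachable F MT (At_T3b \<U> \<V> mt) \<and>
      bba_step F MT (At_T3b \<U> \<V> mt) (At_T4 \<U> \<V> mt \<V>' \<W>' mt')"
    then have "bba_inv F (At_T4 \<U> \<V> mt \<V>' \<W>' mt')"
      using inv bba_inv_step[OF assms(1) ne] by blast
    then have red: "marked_reduced (\<V>' \<union> \<W>') mt'"
      and span: "Kspan (\<V>' \<union> \<W>') = Kspan (pplus \<V>)"
      by (simp_all add: interreduced_pplus_def)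
    show "is_marking (\<V>' \<union> \<W>') mt'" using red by (simp add: marked_reduced_def)
    show "is_K_basis (\<V>' \<union> \<W>') (Kspan (pplus \<V>))" using red span by (rule marked_reduced_is_K_basis)
    show "inj_on mt' (\<V>' \<union> \<W>')" using red by (rule marked_reduced_inj_on)
    show "\<forall>v\<in>\<V>' \<union> \<W>'. \<forall>w\<in>\<V>' \<union> \<W>'. v \<noteq> w \<longrightarrow> mt' v \<notin> supp w"
      using red by (simp add: marked_reduced_def)
  next
    fix s assume s: "bba_reachable F MT s \<and> (\<nexists>s'. bba_step F MT s s')"
    then have inv: "bba_inv F s" using inv by blast
    then have "(\<exists>\<O>. s = Stopped_in_T7 \<O>) \<or> (\<exists>G mt \<O>. s = Output G mt \<O>)"
      using bba_progress[OF assms(1-3)] s by blast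
    then show "(\<exists>\<O>. s = Stopped_in_T7 \<O> \<and> \<not> order_ideal \<O>) \<or>
        (\<exists>G mt \<O>. s = Output G mt \<O> \<and>
          finite \<O> \<and> order_ideal \<O> \<and> is_marking G mt \<and>
          border_basis \<O> G (ideal_of F) \<and>
          (\<forall>g\<in>G. \<forall>t\<in>supp g. t \<in> border \<O> \<longrightarrow> mt g = t))"
      using inv by auto
  }
qed

end
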